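(* Let $A \in \mathcal{A}$, let $t \in A_0$, and let $\tau:\hat{\mathbb{C}} \to \hat{\mathbb{C}}$ be the translation $z \mapsto z-t$ (with $\tau(\infty)=\infty$). Then there exists $N \in \mathbb{N}$ such that for every integer $n \geq N$: (i) $A_0 \subset \mathcal{K}(\tau^{-1} \circ P_{\tau(A),n} \circ \tau)$; (ii) $A_{\infty} \subset \mathcal{L}(\tau^{-1} \circ P_{\tau(A),n} \circ \tau)$; (iii) $\mathcal{J}(\tau^{-1} \circ P_{\tau(A),n} \circ \tau) \subset A$; and (iv) any path from a point of $\partial A_{\infty}$ to a point of $\partial A_0$ has nonempty intersection with $\mathcal{J}(\tau^{-1} \circ P_{\tau(A),n} \circ \tau)$.
   Context: $\hat{\mathbb{C}}=\mathbb{C}\cup\{\infty\}$ is the Riemann sphere. For a rational map $f$ of $\hat{\mathbb{C}}$ for which $\infty$ is an attracting fixed point: $\mathcal{L}(f)$ is the basin of attraction of $\infty$ for $f$ (the set of points whose forward iterates converge to $\infty$), $\mathcal{K}(f)=\hat{\mathbb{C}}\setminus\mathcal{L}(f)$, and $\mathcal{J}(f)=\partial\mathcal{K}(f)$. $\mathcal{A}$ is the collection of all subsets $A\subset\hat{\mathbb{C}}$ that are the closure of an open annulus which is bounded (i.e. disjoint from some ball about $\infty$). Standing assumptions on $A\in\mathcal{A}$: $\hat{\mathbb{C}}\setminus A$ consists of two topological disks, denoted $A_\infty$ (unbounded, containing $\infty$) and $A_0$ (bounded), so $\hat{\mathbb{C}}=A_\infty\sqcup A\sqcup A_0$; and the interior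 of $A$ contains a Jordan curve whose fundamental group injects into $\pi_1(A)$ under inclusion. For each $A\in\mathcal{A}$ the following choices are fixed once and for all. $\gamma_A$ is a Jordan curve contained in the interior of $A$ such that $\pi_1(\gamma_A)$ injects into $\pi_1(A)$ under inclusion. $U_A$ is the unbounded component of $\hat{\mathbb{C}}\setminus\gamma_A$. $\widetilde{\varphi_A}:\{z\in\hat{\mathbb{C}}: 1<|z|\}\to U_A$ is a conformal isomorphism with $\widetilde{\varphi_A}(\infty)=\infty$. $\epsilon=\epsilon(A)>0$ is small enough that $C_A:=\widetilde{\varphi_A}(\{|z|=1+\epsilon\})$ is contained in the interior of $A$. Define $\varphi_A:\{z\in\hat{\mathbb{C}}:\frac{1}{1+\epsilon}<|z|\}\to\hat{\mathbb{C}}$ by $\varphi_A(z)=\widetilde{\varphi_A}((1+\epsilon)z)$, so $\varphi_A$ maps the unit circle onto $C_A$. Its Laurent expansion is $\varphi_A(z)=c_Az+c_{(A,0)}+\frac{c_{(A,1)}}{z}+\frac{c_{(A,2)}}{z^2}+\cdots$ for $|z|\ge 1$; $c_A$ denotes the leading coefficient. For $n\in\mathbb{N}$ and $1\le k\le n$ let $r_A^{(k,n)}=\varphi_A(e^{2\pi i k/n})$, and define polynomials $$\omega_{A,n}(z)=c_A^{-n}\prod_{k=1}^n\left(z-r_A^{(k,n)}\right),\qquad P_{A,n}(z)=z\,(\omega_{A,n}(z)+1).$$ For the translated annulus $\tau(A)=\{\tau(z):z\in A\}\in\mathcal{A}$, $P_{\tau(A),n}$ is the polynomial obtained from this construction applied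 to $\tau(A)$. *)

theory Defs
  imports "HOL-Analysis.Analysis" "HOL-Computational_Algebra.Polynomial"
begin

section \<open>The Riemann sphere\<close>

text \<open>The Riemann sphere is the one-point compactification of the complex plane.  Giving the
  option type the topology of the library's Alexandroff compactification makes the type-class
  notions (closure, frontier, paths, homotopies, limits, ...) available on it.\<close>

instantiation option :: (topological_space) topological_space
begin

definition open_option :: "'a option set \<Rightarrow> bool" where
  "open_option U \<longleftrightarrow> openin (Alexandroff_compactification euclidean) U"

instance
proof
  show "open (UNIV :: 'a option set)"
    using openin_topspace[of "Alexandroff_compactification (euclidean :: 'a topology)"]
    by (simp add: open_option_def topspace_Alexandroff_compactification insert_UNIV
        UNIV_option_conv)
qed (auto simp: open_option_def)

end

lemma euclidean_option:
  "(euclidean :: 'a::topological_space option topology) = Alexandroff_compactification euclidean"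
  by (simp add: topology_eq open_option_def flip: open_openin)

type_synonym riemann_sphere = "complex option"

abbreviation sphere_infinity :: riemann_sphere where
  "sphere_infinity \<equiv> None"

definition sphere_translation :: "complex \<Rightarrow> riemann_sphere \<Rightarrow> riemann_sphere" where
  "sphere_translation t = map_option (\<lambda>z. z - t)"

text \<open>For a nonconstant polynomial this is its extension to the sphere as a rational map.\<close>

definition sphere_poly :: "complex poly \<Rightarrow> riemann_sphere \<Rightarrow> riemann_sphere" where
  "sphere_poly p = map_option (poly p)"

definition sphere_inverse :: "riemann_sphere \<Rightarrow> riemann_sphere" where
  "sphere_inverse z =
     (case z of None \<Rightarrow> Some 0 | Some w \<Rightarrow> if w = 0 then None else Some (inverse w))"

text \<open>Holomorphy of a map on an open subset of the sphere, in the two standard charts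
  \<open>z\<close> and \<open>1/z\<close> on the source (\<open>\<sigma>\<close>) and on the target (\<open>\<rho>\<close>).  Continuity makes the sets on
  which the chart expressions are considered open.\<close>

definition sphere_holomorphic_on ::
    "(riemann_sphere \<Rightarrow> riemann_sphere) \<Rightarrow> riemann_sphere set \<Rightarrow> bool" where
  "sphere_holomorphic_on f S \<longleftrightarrow>
     continuous_on S f \<and>
     (\<forall>\<sigma>\<in>{id, sphere_inverse}. \<forall>\<rho>\<in>{id, sphere_inverse}.
        (\<lambda>w. the (\<rho> (f (\<sigma> (Some w))))) holomorphic_on
          {w. \<sigma> (Some w) \<in> S \<and> \<rho> (f (\<sigma> (Some w))) \<noteq> None})"

definition conformal_isomorphism ::
    "(riemann_sphere \<Rightarrow> riemann_sphere) \<Rightarrow> riemann_sphere set \<Rightarrow> riemann_sphere set \<Rightarrow> bool"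
  where
  "conformal_isomorphism f S T \<longleftrightarrow>
     bij_betw f S T \<and> sphere_holomorphic_on f S \<and> sphere_holomorphic_on (inv_into S f) T"

definition sphere_exterior :: "real \<Rightarrow> riemann_sphere set" where
  "sphere_exterior R = insert sphere_infinity (Some ` {z. R < norm z})"


section \<open>Basin of infinity and Julia set\<close>

definition basin_infinity :: "(riemann_sphere \<Rightarrow> riemann_sphere) \<Rightarrow> riemann_sphere set" where
  "basin_infinity f = {z. (\<lambda>k. (f ^^ k) z) \<longlonglongrightarrow> sphere_infinity}"

definition filled_julia :: "(riemann_sphere \<Rightarrow> riemann_sphere) \<Rightarrow> riemann_sphere set" where
  "filled_julia f = - basin_infinity f"

definition julia :: "(riemann_sphere \<Rightarrow> riemann_sphere) \<Rightarrow> riemann_sphere set" where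
  "julia f = frontier (filled_julia f)"


section \<open>Closed annuli\<close>

definition jordan_curve :: "'a::topological_space set \<Rightarrow> bool" where
  "jordan_curve \<gamma> \<longleftrightarrow>
     (\<exists>g. simple_path g \<and> pathfinish g = pathstart g \<and> \<gamma> = path_image g)"

text \<open>Injectivity of the homomorphism of fundamental groups induced by the inclusion of \<open>S\<close>
  into \<open>T\<close>, for every base point in \<open>S\<close>; elements of the fundamental group are homotopy classes
  of loops, and \<open>homotopic_paths\<close> is homotopy relative to the endpoints.\<close>

definition pi1_injective :: "'a::topological_space set \<Rightarrow> 'a set \<Rightarrow> bool" where
  "pi1_injective S T \<longleftrightarrow>
     S \<subseteq> T \<and>
     (\<forall>p q. path p \<and> path_image p \<subseteq> S \<and> pathfinish p = pathstart p \<and>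
            path q \<and> path_image q \<subseteq> S \<and> pathfinish q = pathstart q \<and>
            pathstart p = pathstart q \<and> homotopic_paths T p q
            \<longrightarrow> homotopic_paths S p q)"

definition core_curve :: "riemann_sphere set \<Rightarrow> riemann_sphere set \<Rightarrow> bool" where
  "core_curve A \<gamma> \<longleftrightarrow> jordan_curve \<gamma> \<and> \<gamma> \<subseteq> interior A \<and> pi1_injective \<gamma> A"

definition outer_disk :: "riemann_sphere set \<Rightarrow> riemann_sphere set" where
  "outer_disk A = connected_component_set (- A) sphere_infinity"

definition inner_disk :: "riemann_sphere set \<Rightarrow> riemann_sphere set" where
  "inner_disk A = - A - outer_disk A"

text \<open>Closures of bounded open annuli, together with the standing assumptions: the complement
  consists of two topological disks, and a core curve exists.\<close>

definition closed_annuli :: "riemann_sphere set set" where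
  "closed_annuli =
     {A. (\<exists>U. open U \<and> U homeomorphic {z::complex. 1 < norm z \<and> norm z < 2} \<and>
              (\<exists>R. U \<inter> sphere_exterior R = {}) \<and> A = closure U) \<and>
         outer_disk A homeomorphic ball (0::complex) 1 \<and>
         inner_disk A homeomorphic ball (0::complex) 1 \<and>
         (\<exists>\<gamma>. core_curve A \<gamma>)}"


section \<open>The polynomials attached to a closed annulus\<close>

text \<open>Here \<open>f\<close> is the Riemann map onto the unbounded complementary component of the curve
  \<open>\<gamma>\<close>, normalised only by fixing infinity.\<close>

definition admissible_choice ::
    "riemann_sphere set \<Rightarrow> riemann_sphere set \<Rightarrow> (riemann_sphere \<Rightarrow> riemann_sphere) \<Rightarrow> real \<Rightarrow> bool"
  where
  "admissible_choice A \<gamma> f \<epsilon> \<longleftrightarrow>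
     core_curve A \<gamma> \<and>
     conformal_isomorphism f (sphere_exterior 1)
       (connected_component_set (- \<gamma>) sphere_infinity) \<and>
     f sphere_infinity = sphere_infinity \<and>
     \<epsilon> > 0 \<and> f ` Some ` {z. norm z = 1 + \<epsilon>} \<subseteq> interior A"

definition rescaled_map :: "(riemann_sphere \<Rightarrow> riemann_sphere) \<Rightarrow> real \<Rightarrow> riemann_sphere \<Rightarrow> riemann_sphere"
  where
  "rescaled_map f \<epsilon> z = f (map_option (\<lambda>w. of_real (1 + \<epsilon>) * w) z)"

text \<open>The coefficient with index \<open>k\<close> belongs to the power \<open>z^(1 - k)\<close>; thus index \<open>0\<close> is the
  leading coefficient.\<close>

definition laurent_coeffs :: "(riemann_sphere \<Rightarrow> riemann_sphere) \<Rightarrow> nat \<Rightarrow> complex" where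
  "laurent_coeffs \<phi> =
     (THE a. \<forall>z. norm z \<ge> 1 \<longrightarrow> (\<lambda>k. a k * z powi (1 - int k)) sums the (\<phi> (Some z)))"

definition leading_coeff :: "(riemann_sphere \<Rightarrow> riemann_sphere) \<Rightarrow> complex" where
  "leading_coeff \<phi> = laurent_coeffs \<phi> 0"

definition node :: "(riemann_sphere \<Rightarrow> riemann_sphere) \<Rightarrow> nat \<Rightarrow> nat \<Rightarrow> complex" where
  "node \<phi> k n = the (\<phi> (Some (exp (2 * of_real pi * \<i> * of_nat k / of_nat n))))"

definition omega_poly :: "(riemann_sphere \<Rightarrow> riemann_sphere) \<Rightarrow> nat \<Rightarrow> complex poly" where
  "omega_poly \<phi> n = smult (inverse (leading_coeff \<phi> ^ n)) (\<Prod>k=1..n. [:- node \<phi> k n, 1:])"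

definition annulus_poly :: "(riemann_sphere \<Rightarrow> riemann_sphere) \<Rightarrow> nat \<Rightarrow> complex poly" where
  "annulus_poly \<phi> n = [:0, 1:] * (omega_poly \<phi> n + 1)"

end

theory Submission
  imports Defs "HOL-Complex_Analysis.Complex_Analysis"
begin

text \<open>
  Let \<open>\<phi>\<close> be the rescaled Riemann map, with leading coefficient \<open>c\<close>, and let the origin lie in the
  inner disk; the general case follows by conjugation with a translation. The polynomials
  \<open>\<omega>\<^sub>n\<close> with zeros at the images of the \<open>n\<close>-th roots of unity behave as they would for \<open>\<phi> = id\<close>, when
  \<open>\<omega>\<^sub>n z = z ^ n - 1\<close>: inside the curve \<open>C = \<phi> {\<bar>w\<bar> = 1}\<close> they tend to \<open>- 1\<close>, and outside they explode.
  Then \<open>P\<^sub>n z = z * (\<omega>\<^sub>n z + 1)\<close> contracts a neighbourhood of the inner disk into a small ball about the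
  origin, so these points have bounded orbits, whereas the points beyond \<open>C\<close> are pushed
  outwards and escape.

  For \<open>z\<close> inside, \<open>- \<omega>\<^sub>n z\<close> is the product over the roots of unity \<open>y\<close> of the values of
  \<open>y * (\<phi> (1 / y) - z) / c\<close>. This function of \<open>y\<close> is holomorphic, takes the value \<open>1\<close> at the origin, and has no zero on a
  disk larger than the unit disk, since \<open>z\<close> lies inside a slightly smaller curve than \<open>C\<close>. The
  sum of the values of its logarithm over the roots of unity involves only Taylor coefficients of
  index divisible by \<open>n\<close> and is exponentially small, so \<open>\<omega>\<^sub>n z\<close> tends to \<open>- 1\<close>, uniformly
  (\<open>omega_inside\<close>). The estimate outside needs no second computation: the quotient of
  \<open>\<omega>\<^sub>n (\<phi> w)\<close> and \<open>w ^ n - 1\<close> has only removable singularities, is close to \<open>1\<close> on a circle \<open>\<bar>w\<bar> = s < 1\<close> by the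
  estimate inside, and hence beyond that circle by the maximum principle (\<open>omega_outside\<close>).

  It remains to place the two disks. The outer disk lies beyond \<open>C\<close> by connectedness
  (\<open>closure_outer_disk_subset\<close>). That the inner disk lies inside the core curve is where injectivity on
  fundamental groups enters: otherwise the curve would bound a disk within \<open>A\<close> and be
  null-homotopic there (\<open>core_curve_separates\<close>). As the closures of the disks end up in the
  interiors of the filled Julia set and of the basin, the Julia set lies in \<open>A\<close> and separates the disks.
\<close>

section \<open>Sums and products over the roots of unity\<close>

definition unity_root :: "nat \<Rightarrow> nat \<Rightarrow> complex" where
  "unity_root n k = exp (2 * of_real pi * \<i> * of_nat k / of_nat n)"

lemma norm_unity_root [simp]: "norm (unity_root n k) = 1"
  by (simp add: unity_root_def)

lemma unity_root_nonzero [simp]: "unity_root n k \<noteq> 0"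
  by (simp add: unity_root_def)

lemma unity_root_power:
  assumes "n > 0" shows "unity_root n k ^ n = 1"
proof -
  have "unity_root n k ^ n = exp (2 * of_real pi * \<i> * of_nat k)"
    using assms by (simp add: unity_root_def flip: exp_of_nat_mult)
  also have "\<dots> = 1"
    by (rule exp_eq_1[THEN iffD2]) (auto intro!: exI[of _ "int k"])
  finally show ?thesis .
qed

lemma unity_root_eq_iff:
  assumes "n > 0" "j \<in> {1..n}" "k \<in> {1..n}"
  shows "unity_root n j = unity_root n k \<longleftrightarrow> j = k"
proof
  assume "unity_root n j = unity_root n k"
  then have "j mod n = k mod n"
    using complex_root_unity_eq[of n j k] assms by (simp add: unity_root_def cong_def)
  then show "j = k"
    using assms by (cases "j = n"; cases "k = n") auto
qed auto

lemma prod_unity_root: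
  assumes n: "n > 0"
  shows "(\<Prod>k=1..n. z - unity_root n k) = z ^ n - 1"
proof -
  define p where "p = (\<Prod>k=1..n. [:- unity_root n k, 1:])"
  define q :: "complex poly" where "q = monom 1 n - 1"
  have dp: "degree p = n"
    by (simp add: p_def degree_prod_eq_sum_degree)
  have lp: "lead_coeff p = 1"
    unfolding p_def lead_coeff_prod by simp
  have dq: "degree q \<le> n"
    unfolding q_def by (intro degree_diff_le degree_monom_le) simp
  have lq: "coeff q n = 1"
    using n by (simp add: q_def)
  have "p = q"
  proof (rule poly_eqI_degree_lead_coeff[where n = n and A = "unity_root n ` {1..n}"])
    have "inj_on (unity_root n) {1..n}"
      using unity_root_eq_iff[OF n] by (auto simp: inj_on_def)
    then show "n \<le> card (unity_root n ` {1..n})"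
      by (simp add: card_image)
    show "poly p x = poly q x" if "x \<in> unity_root n ` {1..n}" for x
    proof -
      have "poly p x = 0"
        using that by (auto simp: p_def poly_prod)
      moreover have "poly q x = 0"
        using that unity_root_power[OF n] by (auto simp: q_def poly_monom)
      ultimately show ?thesis by simp
    qed
  qed (use dp dq lp[unfolded dp] lq in auto)
  then have "poly p z = poly q z" by simp
  then show ?thesis
    by (simp add: p_def q_def poly_prod poly_monom)
qed

lemma sum_inverse_unity_root_power:
  assumes j: "0 < j" "j < n"
  shows "(\<Sum>k=1..n. inverse (unity_root n k) ^ j) = 0"
proof -
  define q where "q = inverse (unity_root n j)"
  have eq: "inverse (unity_root n k) ^ j = q ^ k" for k
    by (simp add: q_def unity_root_def mult_ac flip: exp_of_nat_mult exp_minus power_inverse)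
  have "unity_root n j \<noteq> 1"
    using unity_root_eq_iff[of n j n] j by (simp add: unity_root_def exp_eq_1)
  then have q1: "q \<noteq> 1"
    by (simp add: q_def)
  have qn: "q ^ n = 1"
    using unity_root_power[of n j] j by (simp add: q_def power_inverse)
  have "(\<Sum>k=1..n. q ^ k) = (\<Sum>k<n. q * q ^ k)"
    by (rule sum.reindex_bij_witness[of _ "\<lambda>i. Suc i" "\<lambda>i. i - 1"])
       (auto simp flip: power_Suc)
  also have "\<dots> = q * (\<Sum>k<n. q ^ k)"
    by (simp add: sum_distrib_left)
  also have "(\<Sum>k<n. q ^ k) = 0"
    using q1 qn by (simp add: sum_gp_strict)
  finally show ?thesis
    by (simp add: eq)
qed

text \<open>Averaging over the \<open>n\<close>-th roots of unity annihilates every Taylor coefficient whose index is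
not a multiple of \<open>n\<close>. As \<open>l\<close> has no constant term, only indices \<open>\<ge> n\<close> survive, and Cauchy's
inequality makes their contribution exponentially small. The rate matters: the sum is not
divided by \<open>n\<close>, so that mere convergence of Riemann sums would say nothing.\<close>

lemma norm_sum_unity_root_le:
  fixes l :: "complex \<Rightarrow> complex"
  assumes hol: "l holomorphic_on ball 0 R" and r: "1 < r" "r < R" and l0: "l 0 = 0"
    and B: "\<And>y. norm y = r \<Longrightarrow> norm (l y) \<le> B" and n: "n > 0"
  shows "norm (\<Sum>k=1..n. l (inverse (unity_root n k))) \<le> B / (1 - 1/r) * (n * (1/r) ^ n)"
proof -
  define a where "a j = (deriv ^^ j) l 0 / fact j" for j
  define y where "y k = inverse (unity_root n k)" for k
  have ny [simp]: "norm (y k) = 1" for k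
    by (simp add: y_def norm_inverse)
  have a: "norm (a j) \<le> B * (1/r) ^ j" for j
  proof -
    have "norm ((deriv ^^ j) l 0) \<le> fact j * B / r ^ j"
      using r B by (intro Cauchy_inequality holomorphic_on_subset[OF hol]
          continuous_on_subset[OF holomorphic_on_imp_continuous_on[OF hol]]) auto
    then show ?thesis
      by (simp add: a_def norm_divide field_simps)
  qed
  define f where "f j = (\<Sum>k=1..n. a j * y k ^ j)" for j
  have f_sums: "f sums (\<Sum>k=1..n. l (y k))"
    unfolding f_def
  proof (rule sums_sum)
    fix k
    show "(\<lambda>j. a j * y k ^ j) sums l (y k)"
      using holomorphic_power_series[OF hol, of "y k"] r by (simp add: a_def)
  qed
  have "f j = a j * (\<Sum>k=1..n. y k ^ j)" for j
    by (simp add: f_def sum_distrib_left)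
  then have f0: "f j = 0" if "j < n" for j
    using sum_inverse_unity_root_power[of j n] that l0
    by (cases "j = 0") (auto simp: y_def a_def)
  have fle: "norm (f j) \<le> n * B * (1/r) ^ j" for j
  proof -
    have "norm (f j) \<le> (\<Sum>k=1..n. norm (a j * y k ^ j))"
      unfolding f_def by (rule norm_sum)
    also have "\<dots> = n * norm (a j)"
      by (simp add: norm_mult norm_power)
    also have "\<dots> \<le> n * (B * (1/r) ^ j)"
      using a by (intro mult_left_mono) auto
    finally show ?thesis by (simp add: mult_ac)
  qed
  have geo: "(\<lambda>j. n * B * (1/r) ^ n * (1/r) ^ j) sums (n * B * (1/r) ^ n * (1 / (1 - 1/r)))"
    using r by (intro sums_mult geometric_sums) auto
  have "(\<Sum>k=1..n. l (y k)) = suminf f"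
    using f_sums by (simp add: sums_iff)
  also have "\<dots> = (\<Sum>j. f (j + n))"
    using suminf_split_initial_segment[of f n] f_sums f0 by (simp add: sums_iff)
  finally have "norm (\<Sum>k=1..n. l (y k)) = norm (\<Sum>j. f (j + n))"
    by simp
  also have "\<dots> \<le> (\<Sum>j. n * B * (1/r) ^ n * (1/r) ^ j)"
    using fle[of "_ + n"] geo
    by (intro norm_suminf_le) (auto simp: sums_iff power_add mult_ac)
  also have "\<dots> = n * B * (1/r) ^ n * (1 / (1 - 1/r))"
    using geo by (simp add: sums_iff)
  finally show ?thesis
    by (simp add: y_def mult_ac)
qed

section \<open>Asymptotics of the interpolation polynomials\<close>

text \<open>The function \<open>y \<mapsto> (\<kappa> y - z * y) / \<kappa> 0\<close> is zero-free on a disk of radius greater than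
\<open>1\<close> and equals \<open>1\<close> at the origin, so it has a logarithm that vanishes there, to which the previous
bound applies. Uniformity in \<open>z\<close> comes from the logarithmic derivative, which is an explicit
continuous function of \<open>(z, y)\<close> and is therefore bounded on a compact set.\<close>

lemma prod_unity_root_tendsto_one:
  fixes \<kappa> :: "complex \<Rightarrow> complex"
  assumes hol: "\<kappa> holomorphic_on ball 0 R" and R: "1 < R" and K: "compact K"
    and nz: "\<And>z y. z \<in> K \<Longrightarrow> norm y < R \<Longrightarrow> \<kappa> y - z * y \<noteq> 0"
    and e: "e > 0"
  shows "\<exists>N>0. \<forall>n\<ge>N. \<forall>z\<in>K. norm ((\<Prod>k=1..n.
     (\<kappa> (inverse (unity_root n k)) - z * inverse (unity_root n k)) / \<kappa> 0) - 1) < e"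
proof -
  define r where "r = (1 + R) / 2"
  have r: "1 < r" "r < R" using R by (auto simp: r_def)
  define y where "y n k = inverse (unity_root n k)" for n k
  have ny [simp]: "norm (y n k) = 1" for n k
    by (simp add: y_def norm_inverse)
  define q where "q z u = (deriv \<kappa> u - z) / (\<kappa> u - z * u)" for z u
  have "continuous_on (K \<times> cball 0 r) (\<lambda>x. q (fst x) (snd x))"
  proof -
    have "continuous_on (ball 0 R) \<kappa>" "continuous_on (ball 0 R) (deriv \<kappa>)"
      using hol holomorphic_deriv[OF hol] by (auto intro: holomorphic_on_imp_continuous_on)
    then have "continuous_on (K \<times> cball 0 r) (\<lambda>x. \<kappa> (snd x))"
        "continuous_on (K \<times> cball 0 r) (\<lambda>x. deriv \<kappa> (snd x))"
      using r by (auto intro!: continuous_on_compose2[where f = snd] continuous_on_snd)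
    then show ?thesis
      unfolding q_def using nz r by (intro continuous_intros) auto
  qed
  then have "bounded ((\<lambda>x. q (fst x) (snd x)) ` (K \<times> cball 0 r))"
    using K by (intro compact_imp_bounded compact_continuous_image compact_Times) auto
  then obtain M where "M > 0"
    and M: "\<And>z u. z \<in> K \<Longrightarrow> norm u \<le> r \<Longrightarrow> norm (q z u) \<le> M"
    unfolding bounded_pos by fastforce
  define b where "b n = M * r / (1 - 1/r) * (real n * (1/r) ^ n)" for n
  have key: "\<exists>a. (\<Prod>k=1..n. (\<kappa> (y n k) - z * y n k) / \<kappa> 0) = exp a \<and> norm a \<le> b n"
    if z: "z \<in> K" and n: "n > 0" for z n
  proof -
    define h where "h u = (\<kappa> u - z * u) / \<kappa> 0" for u
    have k0: "\<kappa> 0 \<noteq> 0" using nz[OF z, of 0] R by auto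
    have holh: "h holomorphic_on ball 0 R"
      unfolding h_def by (intro holomorphic_intros hol k0)
    obtain g where g: "g holomorphic_on ball 0 R" "\<And>u. u \<in> ball 0 R \<Longrightarrow> h u = exp (g u)"
      using contractible_imp_holomorphic_log[OF holh] nz[OF z] k0
      by (auto simp: h_def convex_imp_contractible)
    define l where "l u = g u - g 0" for u
    have holl: "l holomorphic_on ball 0 R"
      unfolding l_def by (intro holomorphic_intros g)
    have el: "exp (l u) = h u" if "u \<in> ball 0 R" for u
      using g(2)[OF that] g(2)[of 0] R k0 by (simp add: l_def exp_diff h_def)
    have dl: "(l has_field_derivative q z u) (at u within cball 0 r)" if u: "u \<in> cball 0 r" for u
    proof -
      have uR: "u \<in> ball 0 R" using u r by auto
      have l: "(l has_field_derivative deriv l u) (at u)"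
        using holomorphic_derivI[OF holl open_ball uR] .
      have "((\<lambda>u. exp (l u)) has_field_derivative exp (l u) * deriv l u) (at u)"
        by (rule derivative_eq_intros l refl)+
      then have "(h has_field_derivative exp (l u) * deriv l u) (at u)"
        by (rule has_field_derivative_transform_within_open[OF _ open_ball uR]) (use el in auto)
      moreover have "(h has_field_derivative (deriv \<kappa> u - z) / \<kappa> 0) (at u)"
        unfolding h_def using k0
        by (auto intro!: derivative_eq_intros holomorphic_derivI[OF hol open_ball uR])
      ultimately have "exp (l u) * deriv l u = (deriv \<kappa> u - z) / \<kappa> 0"
        by (rule DERIV_unique)
      then have "(\<kappa> u - z * u) * deriv l u = deriv \<kappa> u - z"
        using k0 by (simp add: el[OF uR] h_def)
      then have "deriv l u = q z u"
        using nz[OF z, of u] uR by (simp add: q_def eq_divide_eq mult_ac)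
      then show ?thesis
        using l by (auto intro: has_field_derivative_at_within)
    qed
    have "norm (l u) \<le> M * r" if "norm u = r" for u
    proof -
      have "norm (l u - l 0) \<le> M * norm (u - 0)"
        by (rule field_differentiable_bound[OF convex_cball[of 0 r] dl M[OF z]])
           (use r that in auto)
      then show ?thesis using that by (simp add: l_def)
    qed
    then have "norm (\<Sum>k=1..n. l (y n k)) \<le> b n"
      unfolding b_def y_def
      by (intro norm_sum_unity_root_le[OF holl r _ _ n]) (auto simp: l_def)
    moreover have "(\<Prod>k=1..n. (\<kappa> (y n k) - z * y n k) / \<kappa> 0) = exp (\<Sum>k=1..n. l (y n k))"
      using R by (simp add: exp_sum el h_def)
    ultimately show ?thesis by blast
  qed
  have "isCont exp (0::complex)" by simp
  then obtain d where d: "d > 0" "\<And>a::complex. norm a < d \<Longrightarrow> norm (exp a - 1) < e"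
    using e by (auto simp: continuous_at_eps_delta dist_norm)
  have "(\<lambda>n. M * r / (1 - 1/r) * (real n * (1/r) ^ n)) \<longlonglongrightarrow> M * r / (1 - 1/r) * 0"
    using r by (intro tendsto_mult powser_times_n_limit_0 tendsto_const) auto
  then have "b \<longlonglongrightarrow> 0"
    by (simp add: b_def[abs_def])
  then have "eventually (\<lambda>n. b n < d) sequentially"
    using d by (auto intro: order_tendstoD)
  then obtain N where N: "\<And>n. n \<ge> N \<Longrightarrow> b n < d"
    by (auto simp: eventually_sequentially)
  show ?thesis
  proof (intro exI[of _ "Suc N"] conjI allI impI ballI)
    fix n z assume "Suc N \<le> n" "z \<in> K"
    then obtain a where "(\<Prod>k=1..n. (\<kappa> (y n k) - z * y n k) / \<kappa> 0) = exp a" "norm a \<le> b n"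
      using key[of z n] by auto
    with N[of n] \<open>Suc N \<le> n\<close> d(2)[of a]
    show "norm ((\<Prod>k=1..n. (\<kappa> (inverse (unity_root n k)) - z * inverse (unity_root n k)) / \<kappa> 0) - 1) < e"
      by (auto simp: y_def)
  qed auto
qed

lemma filterlim_power_at_top_gt1:
  assumes "1 < (d :: real)" shows "filterlim (\<lambda>n. d ^ n) at_top sequentially"
proof -
  have "filterlim (\<lambda>n. norm (d ^ n)) at_top sequentially"
    using assms by (intro filterlim_at_infinity_imp_norm_at_top filterlim_realpow_sequentially_gt1) auto
  moreover have "norm (d ^ n) = d ^ n" for n
    using assms by simp
  ultimately show ?thesis by simp
qed

lemma norm_inverse_less_iff:
  fixes w :: "'a :: real_normed_div_algebra"
  assumes "0 < s" "w \<noteq> 0"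
  shows "norm (inverse w) < 1 / s \<longleftrightarrow> s < norm w" "s < norm (inverse w) \<longleftrightarrow> norm w < 1 / s"
    "norm (inverse w) \<le> 1 / s \<longleftrightarrow> s \<le> norm w"
proof -
  have "norm w > 0" using assms by simp
  then show "norm (inverse w) < 1 / s \<longleftrightarrow> s < norm w" "s < norm (inverse w) \<longleftrightarrow> norm w < 1 / s"
    "norm (inverse w) \<le> 1 / s \<longleftrightarrow> s \<le> norm w"
    using assms(1) unfolding norm_inverse by (simp_all only: pos_less_divide_eq pos_divide_less_eq pos_le_divide_eq pos_divide_le_eq inverse_eq_divide mult.commute mult_1_left mult_1_right times_divide_eq_left times_divide_eq_right)
qed

lemma connected_exterior: "connected {w::complex. r < norm w}"
  using connected_complement_bounded_convex[of "cball (0::complex) r"]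
  by (auto simp: Compl_eq not_le)

text \<open>A univalent function with a simple pole at infinity, encoded by the holomorphic function
\<open>\<kappa> x = x * \<phi> (1 / x)\<close> near the origin. All Taylor coefficients of \<open>\<kappa>\<close> are Laurent coefficients of
\<open>\<phi>\<close>; in particular \<open>\<kappa> 0\<close> is the leading one. The unit circle, on which the nodes are placed,
lies strictly inside the domain because \<open>\<rho> > 1\<close>.\<close>

locale exterior_map =
  fixes \<kappa> :: "complex \<Rightarrow> complex" and \<rho> :: real
  assumes rho: "1 < \<rho>"
    and kappa_holomorphic: "\<kappa> holomorphic_on ball 0 \<rho>"
    and kappa_0: "\<kappa> 0 \<noteq> 0"
    and inj: "inj_on (\<lambda>w. w * \<kappa> (inverse w)) {w. 1 / \<rho> < norm w}"
begin

definition phi :: "complex \<Rightarrow> complex" where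
  "phi w = w * \<kappa> (inverse w)"

definition phi_ext :: "real \<Rightarrow> complex set" where
  "phi_ext r = phi ` {w. r < norm w}"

definition omega :: "nat \<Rightarrow> complex \<Rightarrow> complex" where
  "omega n z = (\<Prod>k=1..n. (z - phi (unity_root n k)) / \<kappa> 0)"

definition P :: "nat \<Rightarrow> complex \<Rightarrow> complex" where
  "P n z = z * (omega n z + 1)"

lemma phi_inj: "inj_on phi {w. 1 / \<rho> < norm w}"
  using inj by (simp add: phi_def[abs_def])

lemma inverse_rho: "0 < 1 / \<rho>" "1 / \<rho> < 1"
  using rho by auto

lemma norm_inverse_less:
  fixes w :: complex
  assumes "1 / \<rho> < norm w" shows "norm (inverse w) < \<rho>"
proof -
  have "w \<noteq> 0" using assms inverse_rho by auto
  then have "norm (inverse w) < 1 / (1 / \<rho>)"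
    using assms by (subst norm_inverse_less_iff[OF inverse_rho(1)])
  then show ?thesis by simp
qed

lemma phi_holomorphic: "phi holomorphic_on {w. 1 / \<rho> < norm w}"
proof -
  have "inverse holomorphic_on {w::complex. 1 / \<rho> < norm w}"
    using inverse_rho by (intro holomorphic_intros) auto
  then have "(\<kappa> \<circ> inverse) holomorphic_on {w. 1 / \<rho> < norm w}"
    by (rule holomorphic_on_compose_gen[OF _ kappa_holomorphic]) (simp add: norm_inverse_less image_subset_iff)
  then show ?thesis
    unfolding phi_def[abs_def] o_def by (intro holomorphic_intros)
qed

lemma phi_continuous: "1 / \<rho> < r \<Longrightarrow> continuous_on {w. r \<le> norm w} phi"
  by (rule continuous_on_subset[OF holomorphic_on_imp_continuous_on[OF phi_holomorphic]]) auto

lemma phi_large: obtains T where "T > 0" "\<And>w. T \<le> norm w \<Longrightarrow> M \<le> norm (phi w)"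
proof -
  have "isCont \<kappa> 0"
    by (rule continuous_on_interior[OF holomorphic_on_imp_continuous_on[OF kappa_holomorphic]])
      (use rho in auto)
  moreover have "norm (\<kappa> 0) / 2 > 0"
    using kappa_0 by simp
  ultimately obtain d where d: "d > 0" "\<And>y. norm y < d \<Longrightarrow> norm (\<kappa> y - \<kappa> 0) < norm (\<kappa> 0) / 2"
    unfolding continuous_at_eps_delta dist_norm by (metis diff_zero)
  \<comment> \<open>Beyond \<open>T\<close> the value \<open>\<kappa> (inverse w)\<close> has at least half the modulus of \<open>\<kappa> 0\<close>.\<close>
  define T where "T = max (2 / d) (max 1 (2 * M / norm (\<kappa> 0)))"
  show ?thesis
  proof
    show "T > 0" by (simp add: T_def)
    fix w :: complex assume w: "T \<le> norm w"
    then have "w \<noteq> 0" "1 / d < norm w" using d(1) by (auto simp: T_def field_simps)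
    then have "norm (inverse w) < d"
      using d norm_inverse_less_iff(1)[of "1 / d" w] by simp
    from d(2)[OF this] have k: "norm (\<kappa> 0) / 2 \<le> norm (\<kappa> (inverse w))"
      using norm_triangle_ineq2[of "\<kappa> 0" "\<kappa> (inverse w)"] by (simp add: norm_minus_commute)
    have "2 * M / norm (\<kappa> 0) \<le> norm w"
      using w by (simp add: T_def)
    then have "M \<le> norm w * (norm (\<kappa> 0) / 2)"
      using kappa_0 by (simp add: field_simps)
    also have "\<dots> \<le> norm w * norm (\<kappa> (inverse w))"
      using k by (intro mult_left_mono) auto
    finally show "M \<le> norm (phi w)"
      by (simp add: phi_def norm_mult)
  qed
qed

lemma open_phi_ext:
  assumes "1 / \<rho> \<le> r" shows "open (phi_ext r)"
  unfolding phi_ext_def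
proof (rule open_mapping_thm3)
  show "phi holomorphic_on {w. r < norm w}"
    by (rule holomorphic_on_subset[OF phi_holomorphic]) (use assms in auto)
  show "inj_on phi {w. r < norm w}"
    by (rule inj_on_subset[OF phi_inj]) (use assms in auto)
  show "open {w::complex. r < norm w}"
    by (intro open_Collect_less continuous_intros)
qed

lemma closed_phi_image:
  assumes "1 / \<rho> < r" shows "closed (phi ` {w. r \<le> norm w})"
proof -
  have "z \<in> phi ` {w. r \<le> norm w}" if z: "z \<in> closure (phi ` {w. r \<le> norm w})" for z
  proof -
    obtain T where T: "\<And>w. T \<le> norm w \<Longrightarrow> norm z + 1 \<le> norm (phi w)"
      using phi_large by blast
    have "compact (cball (0::complex) T \<inter> {w. r \<le> norm w})"
      by (intro compact_Int_closed closed_Collect_le continuous_intros) auto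
    then have "compact (phi ` (cball 0 T \<inter> {w. r \<le> norm w}))"
      using phi_continuous[OF assms]
      by (intro compact_continuous_image) (auto intro: continuous_on_subset)
    then have cl: "closed (phi ` (cball 0 T \<inter> {w. r \<le> norm w}))" (is "closed ?C")
      by (rule compact_imp_closed)
    have "z \<in> closure (ball z 1 \<inter> phi ` {w. r \<le> norm w})"
      using z open_Int_closure_subset[of "ball z 1" "phi ` {w. r \<le> norm w}"] by auto
    also have "\<dots> \<subseteq> closure ?C"
    proof (rule closure_mono, safe)
      fix w assume w: "phi w \<in> ball z 1" "r \<le> norm w"
      then have "norm (phi w) < norm z + 1"
        using norm_triangle_ineq2[of "phi w" z] by (simp add: dist_norm norm_minus_commute)
      with T[of w] have "norm w < T" by force
      with w show "phi w \<in> ?C" by auto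
    qed
    finally show ?thesis using cl by auto
  qed
  then show ?thesis
    using closure_subset_eq by blast
qed

lemma phi_image_eq_iff:
  fixes w :: complex
  assumes "1 / \<rho> \<le> r" "1 / \<rho> < norm w"
  shows "phi w \<in> phi_ext r \<longleftrightarrow> r < norm w"
  using inj_onD[OF phi_inj, of w] assms by (force simp: phi_ext_def)

text \<open>The frontier of the image lies in the compact image of the circle. Outside a large disk there is
thus no frontier point, so this connected region, which the image meets, lies in the image.\<close>

lemma bounded_compl_phi_ext:
  assumes r: "1 / \<rho> < r" shows "bounded (- phi_ext r)"
proof -
  have r0: "0 < r" using r inverse_rho by linarith
  have "compact (phi ` sphere 0 r)"
    by (intro compact_continuous_image continuous_on_subset[OF phi_continuous[OF r]]) auto
  then obtain M where M: "\<And>z. z \<in> phi ` sphere 0 r \<Longrightarrow> norm z \<le> M"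
    using compact_imp_bounded[of "phi ` sphere 0 r"] unfolding bounded_iff by blast
  have fr: "frontier (phi_ext r) \<subseteq> phi ` sphere 0 r"
  proof
    fix z assume z: "z \<in> frontier (phi_ext r)"
    have "closure (phi_ext r) \<subseteq> phi ` {w. r \<le> norm w}"
      by (rule closure_minimal) (auto simp: phi_ext_def closed_phi_image r)
    moreover have "z \<notin> phi_ext r" "z \<in> closure (phi_ext r)"
      using z open_phi_ext[of r] r by (auto simp: frontier_def interior_open)
    ultimately obtain w where "z = phi w" "r \<le> norm w" "\<not> r < norm w"
      by (force simp: phi_ext_def)
    then show "z \<in> phi ` sphere 0 r"
      by auto
  qed
  define E where "E = {z::complex. M < norm z}"
  obtain T where T: "\<And>w. T \<le> norm w \<Longrightarrow> M + 1 \<le> norm (phi w)"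
    using phi_large by blast
  have "phi (of_real (max T (r + 1))) \<in> E \<inter> phi_ext r"
    using T[of "of_real (max T (r + 1))"] r0 unfolding E_def phi_ext_def by force
  moreover have "E \<inter> frontier (phi_ext r) = {}"
    using fr M by (force simp: E_def)
  ultimately have "E - phi_ext r = {}"
    using connected_Int_frontier[OF connected_exterior[of M], of "phi_ext r"] by (auto simp: E_def)
  then have "- phi_ext r \<subseteq> cball 0 M"
    by (fastforce simp: E_def subset_iff not_le[symmetric])
  then show ?thesis
    using bounded_cball bounded_subset by blast
qed

lemma compact_compl_phi_ext: "1 / \<rho> < r \<Longrightarrow> compact (- phi_ext r)"
  using bounded_compl_phi_ext open_phi_ext[of r] by (simp add: compact_eq_bounded_closed closed_Compl)

text \<open>Writing \<open>z - phi \<zeta> = - \<zeta> * (\<kappa> y - z * y)\<close> with \<open>y = 1 / \<zeta>\<close> splits \<open>omega n z\<close> into the product of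
the numbers \<open>- \<zeta>\<close>, which is \<open>- 1\<close> by \<open>prod_unity_root\<close> at the origin, and a product that tends to
\<open>1\<close>. The factors of the latter do not vanish for \<open>\<bar>y\<bar> < 1 / s\<close>, precisely because \<open>z\<close> is not a value
of \<open>phi\<close> outside the circle of radius \<open>s\<close>.\<close>

lemma omega_inside:
  assumes s: "1 / \<rho> < s" "s < 1" and e: "e > 0"
  shows "\<exists>N>0. \<forall>n\<ge>N. \<forall>z. z \<notin> phi_ext s \<longrightarrow> norm (omega n z + 1) < e"
proof -
  have s0: "0 < s" using s inverse_rho by linarith
  have "ball 0 (1/s) \<subseteq> ball (0::complex) \<rho>"
    using s s0 rho by (intro subset_ball) (simp add: field_simps)
  then have hol: "\<kappa> holomorphic_on ball 0 (1/s)"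
    using kappa_holomorphic holomorphic_on_subset by blast
  have nz: "\<kappa> y - z * y \<noteq> 0" if z: "z \<in> - phi_ext s" and y: "norm y < 1/s" for z y
  proof (cases "y = 0")
    case False
    have "s < norm (inverse y)"
      using y s0 False norm_inverse_less_iff(2)[of s y] by simp
    then have "z \<noteq> phi (inverse y)"
      using z by (auto simp: phi_ext_def)
    then show ?thesis using False by (auto simp: phi_def field_simps)
  qed (use kappa_0 in auto)
  have eq: "omega n z + 1 = - ((\<Prod>k=1..n.
     (\<kappa> (inverse (unity_root n k)) - z * inverse (unity_root n k)) / \<kappa> 0) - 1)"
    if "n > 0" for n z
  proof -
    have "omega n z = (\<Prod>k=1..n. - unity_root n k * ((\<kappa> (inverse (unity_root n k))
            - z * inverse (unity_root n k)) / \<kappa> 0))"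
      unfolding omega_def phi_def times_divide_eq_right by (intro prod.cong) (auto simp: algebra_simps)
    also have "\<dots> = (\<Prod>k=1..n. 0 - unity_root n k) * (\<Prod>k=1..n. ((\<kappa> (inverse (unity_root n k))
            - z * inverse (unity_root n k)) / \<kappa> 0))"
      by (simp only: prod.distrib diff_0)
    also have "(\<Prod>k=1..n. 0 - unity_root n k) = -1"
      using that by (subst prod_unity_root) auto
    finally show ?thesis by simp
  qed
  obtain N where "N > 0" and N: "\<forall>n\<ge>N. \<forall>z\<in>- phi_ext s. norm ((\<Prod>k=1..n.
     (\<kappa> (inverse (unity_root n k)) - z * inverse (unity_root n k)) / \<kappa> 0) - 1) < e"
    using prod_unity_root_tendsto_one[OF hol _ compact_compl_phi_ext[OF s(1)] nz e] s s0 by auto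
  show ?thesis
    by (intro exI[of _ N] conjI allI impI \<open>N > 0\<close>, subst eq)
       (use N \<open>N > 0\<close> in \<open>auto simp: norm_minus_commute\<close>)
qed

text \<open>Both \<open>omega n (phi w)\<close> and \<open>w ^ n - 1\<close> vanish at the roots of unity and grow like \<open>w ^ n\<close> at
infinity, so their quotient extends holomorphically, infinity included.\<close>

lemma omega_phi_factorization:
  assumes n: "n > 0"
  obtains R where "R holomorphic_on ball 0 \<rho>"
    "\<And>w. 1 / \<rho> < norm w \<Longrightarrow> omega n (phi w) = (w ^ n - 1) * R (inverse w)"
proof -
  define y where "y k = inverse (unity_root n k)" for k
  define m where "m k x = (\<kappa> x - x * phi (unity_root n k)) / \<kappa> 0" for k x
  define q where "q k x = (if x = y k then deriv (m k) (y k) else (m k x - m k (y k)) / (x - y k))"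
    for k x
  have holm: "m k holomorphic_on ball 0 \<rho>" for k
    unfolding m_def by (intro holomorphic_intros kappa_holomorphic kappa_0)
  have holq: "q k holomorphic_on ball 0 \<rho>" for k
    unfolding q_def by (rule pole_lemma_open[OF holm open_ball])
  have my: "m k (y k) = 0" for k
    by (simp add: m_def y_def phi_def)
  have mq: "m k x = (x - y k) * q k x" for k x
    by (simp add: q_def my)
  define R where "R x = (\<Prod>k=1..n. - y k * q k x)" for x
  show ?thesis
  proof
    show "R holomorphic_on ball 0 \<rho>"
      unfolding R_def by (intro holomorphic_intros holq)
    fix w :: complex assume w: "1 / \<rho> < norm w"
    then have w0: "w \<noteq> 0" using inverse_rho by auto
    have "(phi w - phi (unity_root n k)) / \<kappa> 0 = (w - unity_root n k) * (- y k * q k (inverse w))" for k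
    proof -
      have "(phi w - phi (unity_root n k)) / \<kappa> 0 = w * m k (inverse w)"
        using w0 kappa_0 by (simp add: phi_def m_def field_simps)
      also have "\<dots> = w * (inverse w - y k) * q k (inverse w)"
        by (simp add: mq)
      also have "w * (inverse w - y k) = (w - unity_root n k) * (- y k)"
        using w0 by (simp add: y_def field_simps)
      finally show ?thesis by (simp add: mult_ac)
    qed
    then show "omega n (phi w) = (w ^ n - 1) * R (inverse w)"
      by (simp only: omega_def R_def prod.distrib prod_unity_root[OF n])
  qed
qed

text \<open>The quotient \<open>R\<close> of \<open>omega n (phi w)\<close> and \<open>w ^ n - 1\<close> is close to \<open>1\<close> on the circle \<open>\<bar>w\<bar> = s\<close>, where
both functions are close to \<open>- 1\<close>. The maximum principle, applied to \<open>R - 1\<close> in the coordinate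
\<open>1 / w\<close>, carries this over to the whole exterior of the circle.\<close>

lemma omega_outside:
  assumes s: "1 / \<rho> < s" "s < 1"
  shows "\<exists>N. \<forall>n\<ge>N. \<forall>w::complex. s \<le> norm w \<longrightarrow> norm (w ^ n - 1) / 2 \<le> norm (omega n (phi w))"
proof -
  have s0: "0 < s" using s inverse_rho by linarith
  obtain N1 where N1: "N1 > 0" "\<And>n z. n \<ge> N1 \<Longrightarrow> z \<notin> phi_ext s \<Longrightarrow> norm (omega n z + 1) < 1/8"
    using omega_inside[OF s, of "1/8"] by auto
  have "(\<lambda>n. s ^ n) \<longlonglongrightarrow> 0"
    using s s0 by (intro LIMSEQ_power_zero) auto
  then have "eventually (\<lambda>n. s ^ n < 1/8) sequentially"
    by (rule order_tendstoD) simp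
  then obtain N2 where N2: "\<And>n. n \<ge> N2 \<Longrightarrow> s ^ n < 1/8"
    by (auto simp: eventually_sequentially)
  have "norm ((w::complex) ^ n - 1) / 2 \<le> norm (omega n (phi w))"
    if n: "n \<ge> max N1 N2" and w: "s \<le> norm w" for n w
  proof -
    have n0: "n > 0" using n N1(1) by auto
    obtain R where holR: "R holomorphic_on ball 0 \<rho>"
      and R: "\<And>w. 1 / \<rho> < norm w \<Longrightarrow> omega n (phi w) = (w ^ n - 1) * R (inverse w)"
      using omega_phi_factorization[OF n0] by blast
    have sub: "cball 0 (1/s) \<subseteq> ball (0::complex) \<rho>"
      using s s0 rho by (intro cball_subset_ball_iff[THEN iffD2] disjI1) (simp add: field_simps)
    have "norm (R (inverse w) - 1) \<le> 1/2"
    proof (rule maximum_modulus_frontier[where S = "cball 0 (1/s)" and f = "\<lambda>x. R x - 1"])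
      show "(\<lambda>x. R x - 1) holomorphic_on interior (cball 0 (1/s))"
        using sub by (intro holomorphic_intros holomorphic_on_subset[OF holR]) auto
      show "continuous_on (closure (cball 0 (1/s))) (\<lambda>x. R x - 1)"
        using sub by (intro continuous_intros continuous_on_subset[OF holomorphic_on_imp_continuous_on[OF holR]]) auto
      show "inverse w \<in> cball 0 (1/s)"
        using w s0 norm_inverse_less_iff(3)[of s w] by (cases "w = 0") auto
      fix x :: complex assume "x \<in> frontier (cball 0 (1/s))"
      then have x: "norm x = 1/s"
        using s0 by simp
      define v where "v = inverse x"
      have v: "norm v = s" "x = inverse v" using x s0 by (auto simp: v_def norm_inverse)
      have "phi v \<notin> phi_ext s"
        using phi_image_eq_iff[of s v] v s by simp
      then have "norm (omega n (phi v) + 1) < 1/8"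
        using N1 n by simp
      moreover have vn: "norm (v ^ n) < 1/8"
        using N2[of n] n v by (simp add: norm_power)
      ultimately have "norm ((omega n (phi v) + 1) - v ^ n) < 1/4"
        using norm_triangle_ineq4[of "omega n (phi v) + 1" "v ^ n"] by linarith
      also have "(omega n (phi v) + 1) - v ^ n = (v ^ n - 1) * (R x - 1)"
        using R[of v] v s by (simp add: algebra_simps)
      finally have less: "norm (v ^ n - 1) * norm (R x - 1) < 1/4"
        by (simp add: norm_mult)
      have ge: "7/8 \<le> norm (v ^ n - 1)"
        using vn norm_triangle_ineq2[of 1 "v ^ n"] by (simp add: norm_minus_commute)
      show "norm (R x - 1) \<le> 1/2"
      proof (rule ccontr)
        assume "\<not> ?thesis"
        then have "7/8 * (1/2) \<le> norm (v ^ n - 1) * norm (R x - 1)"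
          using ge by (intro mult_mono) auto
        with less show False by simp
      qed
    qed auto
    then have "1/2 \<le> norm (R (inverse w))"
      using norm_triangle_ineq2[of 1 "R (inverse w)"] by (simp add: norm_minus_commute)
    then have "norm (w ^ n - 1) * (1/2) \<le> norm (w ^ n - 1) * norm (R (inverse w))"
      by (intro mult_left_mono) auto
    then show ?thesis
      using R[of w] w s by (simp add: norm_mult)
  qed
  then show ?thesis by blast
qed

lemma P_inside:
  assumes s: "1 / \<rho> < s" "s < 1" and 0: "0 \<notin> phi_ext (1 / \<rho>)"
  shows "\<exists>N. \<forall>n\<ge>N. \<forall>z. z \<notin> phi_ext s \<longrightarrow> P n z \<notin> phi_ext s"
proof -
  have "0 \<in> - phi ` {w. s \<le> norm w}"
    using 0 s by (auto simp: phi_ext_def)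
  then obtain h where h: "h > 0" "ball 0 h \<subseteq> - phi ` {w. s \<le> norm w}"
    using closed_phi_image[OF s(1)] openE[of "- phi ` {w. s \<le> norm w}" 0] by (auto simp: open_Compl)
  obtain M where M: "M > 0" "\<And>z. z \<notin> phi_ext s \<Longrightarrow> norm z \<le> M"
    using bounded_compl_phi_ext[OF s(1)] by (auto simp: bounded_pos)
  obtain N where N: "\<And>n z. n \<ge> N \<Longrightarrow> z \<notin> phi_ext s \<Longrightarrow> norm (omega n z + 1) < h / M"
    using omega_inside[OF s, of "h / M"] h(1) M(1) by auto
  have "P n z \<notin> phi_ext s" if "n \<ge> N" "z \<notin> phi_ext s" for n z
  proof -
    have "norm (P n z) = norm z * norm (omega n z + 1)"
      by (simp add: P_def norm_mult)
    also have "\<dots> \<le> M * norm (omega n z + 1)"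
      using M that by (intro mult_right_mono) auto
    also have "\<dots> < h"
      using N[OF that] M(1) by (simp add: field_simps)
    finally have "P n z \<in> ball 0 h" by simp
    with h(2) show ?thesis by (auto simp: phi_ext_def)
  qed
  then show ?thesis by blast
qed

text \<open>Since \<open>omega n\<close> grows at least like \<open>d ^ n\<close> on the exterior region and the origin stays away from it, \<open>P n\<close>
there at least doubles the modulus, and moreover sends every point so far out that it lies in the
region again.\<close>

lemma P_outside:
  assumes d: "1 < d" and 0: "0 \<notin> phi_ext (1 / \<rho>)"
  shows "\<exists>N. \<forall>n\<ge>N. \<forall>z\<in>phi_ext d. filterlim (\<lambda>k. (P n ^^ k) z) at_infinity sequentially"
proof -
  have d': "1 / \<rho> < d" using d inverse_rho by linarith
  have "0 \<in> - phi ` {w. d \<le> norm w}"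
    using 0 d' by (auto simp: phi_ext_def)
  then obtain h where h: "h > 0" "ball 0 h \<subseteq> - phi ` {w. d \<le> norm w}"
    using closed_phi_image[OF d'] openE[of "- phi ` {w. d \<le> norm w}" 0] by (auto simp: open_Compl)
  have hle: "h \<le> norm z" if "z \<in> phi_ext d" for z
    using h(2) that by (force simp: phi_ext_def)
  obtain M where M: "M > 0" "\<And>z. z \<notin> phi_ext d \<Longrightarrow> norm z \<le> M"
    using bounded_compl_phi_ext[OF d'] by (auto simp: bounded_pos)
  obtain s where s: "1 / \<rho> < s" "s < 1"
    using dense[OF inverse_rho(2)] by blast
  obtain N1 where N1:
    "\<And>n (w::complex). n \<ge> N1 \<Longrightarrow> s \<le> norm w \<Longrightarrow> norm (w ^ n - 1) / 2 \<le> norm (omega n (phi w))"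
    using omega_outside[OF s] by auto
  \<comment> \<open>A factor \<open>B\<close> doubles the modulus and takes every modulus \<open>\<ge> h\<close> beyond \<open>M\<close>.\<close>
  define B where "B = max 2 ((M + 1) / h)"
  have "filterlim (\<lambda>n. d ^ n) at_top sequentially"
    using d by (rule filterlim_power_at_top_gt1)
  then obtain N2 where N2: "\<And>n. n \<ge> N2 \<Longrightarrow> d ^ n \<ge> 2 * B + 3"
    by (auto simp: filterlim_at_top eventually_sequentially)
  have step: "P n z \<in> phi_ext d \<and> 2 * norm z \<le> norm (P n z)"
    if n: "n \<ge> max N1 N2" and z: "z \<in> phi_ext d" for n z
  proof -
    obtain w where w: "z = phi w" "d < norm w" using z by (auto simp: phi_ext_def)
    have "2 * B + 3 \<le> norm (w ^ n)"
      using N2[of n] n power_mono[of d "norm w" n] w d by (simp add: norm_power)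
    then have "2 * B + 2 \<le> norm (w ^ n - 1)"
      using norm_triangle_ineq2[of "w ^ n" 1] by simp
    then have "B + 1 \<le> norm (omega n z)"
      using N1[of n w] n w d s by simp
    then have "B \<le> norm (omega n z + 1)"
      using norm_triangle_ineq2[of "omega n z" "-1"] by simp
    then have ge: "norm z * B \<le> norm (P n z)"
      by (auto simp: P_def norm_mult intro: mult_left_mono)
    have "2 * norm z \<le> norm z * B"
      by (simp add: B_def mult.commute mult_left_mono)
    moreover have "h * ((M + 1) / h) \<le> norm z * B"
      using hle[OF z] h(1) M(1) by (intro mult_mono) (auto simp: B_def)
    ultimately have "2 * norm z \<le> norm (P n z)" "M + 1 \<le> norm (P n z)"
      using ge h(1) by auto
    then show ?thesis using M(2)[of "P n z"] by force
  qed
  have "filterlim (\<lambda>k. (P n ^^ k) z) at_infinity sequentially"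
    if n: "n \<ge> max N1 N2" and z: "z \<in> phi_ext d" for n z
  proof -
    have iter: "(P n ^^ k) z \<in> phi_ext d \<and> 2 ^ k * h \<le> norm ((P n ^^ k) z)" for k
    proof (induction k)
      case 0
      then show ?case using z hle[OF z] by simp
    next
      case (Suc k)
      then show ?case using step[OF n, of "(P n ^^ k) z"] by auto
    qed
    have "filterlim (\<lambda>k. 2 ^ k * h) at_top sequentially"
      using h(1) by (intro filterlim_at_top_mult_tendsto_pos[OF tendsto_const]
          filterlim_power_at_top_gt1) auto
    then have "filterlim (\<lambda>k. norm ((P n ^^ k) z)) at_top sequentially"
      by (rule filterlim_at_top_mono) (use iter in auto)
    then show ?thesis
      by (rule filterlim_norm_at_top_imp_at_infinity)
  qed
  then show ?thesis by blast
qed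

end

section \<open>The topology of the Riemann sphere\<close>

lemma vimage_Some_image [simp]: "Some -` Some ` S = S"
  by auto

text \<open>This reduces the topology of the sphere to that of the plane: neighbourhoods of infinity are
the sets with compact complement.\<close>

lemma open_sphere_iff:
  fixes U :: "riemann_sphere set"
  shows "open U \<longleftrightarrow> open (Some -` U) \<and> (None \<in> U \<longrightarrow> compact (- (Some -` U)))"
    (is "?L \<longleftrightarrow> ?R")
proof
  assume ?L
  then consider V where "open V" "U = Some ` V"
    | C where "compact C" "U = insert None (Some ` (- C))"
    by (auto simp: open_option_def openin_Alexandroff_compactification Compl_eq_Diff_UNIV)
  then show ?R
  proof cases
    case 2
    then have "Some -` U = - C" by auto
    with 2 show ?thesis by (simp add: compact_imp_closed open_Compl)
  qed auto
next
  assume R: ?R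
  show ?L
  proof (cases "None \<in> U")
    case True
    then have "U = insert None (Some ` (- (- (Some -` U))))"
      unfolding set_eq_iff by (auto simp: split_option_all)
    with R True show ?thesis
      unfolding open_option_def openin_Alexandroff_compactification
      by (auto simp: compact_imp_closed Compl_eq_Diff_UNIV)
  next
    case False
    then have "U = Some ` (Some -` U)"
      unfolding set_eq_iff by (auto simp: split_option_all)
    with R show ?thesis
      unfolding open_option_def openin_Alexandroff_compactification by auto
  qed
qed

lemma vimage_Some_insert_None [simp]: "Some -` insert None S = Some -` S"
  by auto

lemma open_Some_image: "open S \<Longrightarrow> open (Some ` S :: riemann_sphere set)"
  by (subst open_sphere_iff) auto

lemma open_insert_None:
  "open S \<Longrightarrow> bounded (- S) \<Longrightarrow> open (insert None (Some ` S) :: riemann_sphere set)"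
  by (subst open_sphere_iff) (auto simp: compact_eq_bounded_closed closed_Compl)

lemma closed_Some_image:
  "compact S \<Longrightarrow> closed (Some ` S :: riemann_sphere set)"
  unfolding closed_def by (subst open_sphere_iff) (auto simp: vimage_Compl compact_imp_closed open_Compl)

lemma continuous_on_Some: "continuous_on S (Some :: complex \<Rightarrow> riemann_sphere)"
proof (rule continuous_on_subset)
  show "continuous_on UNIV (Some :: complex \<Rightarrow> riemann_sphere)"
    by (subst continuous_on_open_vimage) (auto simp: open_sphere_iff)
qed simp

lemma continuous_on_the:
  fixes S :: "riemann_sphere set"
  assumes "None \<notin> S" shows "continuous_on S the"
proof (rule continuous_on_subset)
  show "continuous_on (range Some :: riemann_sphere set) the"
  proof (subst continuous_on_open_vimage)
    show "open (range Some :: riemann_sphere set)"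
      by (rule open_Some_image) simp
    show "\<forall>B. open B \<longrightarrow> open (the -` B \<inter> range Some :: riemann_sphere set)"
    proof (intro allI impI)
      fix B :: "complex set" assume "open B"
      moreover have "the -` B \<inter> range Some = Some ` B" by auto
      ultimately show "open (the -` B \<inter> range Some :: riemann_sphere set)"
        by (simp add: open_Some_image)
    qed
  qed
  show "S \<subseteq> range Some"
    using assms by (metis option.exhaust rangeI subsetI)
qed

lemma compact_UNIV_sphere: "compact (UNIV :: riemann_sphere set)"
proof -
  have "compact_space (euclidean :: riemann_sphere topology)"
    by (simp add: euclidean_option)
  then show ?thesis
    by (simp add: compact_space_def)
qed

lemma closed_imp_compact_sphere: "closed (S :: riemann_sphere set) \<Longrightarrow> compact S"
  using compact_Int_closed[OF compact_UNIV_sphere] by simp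

lemma tendsto_infinity_sphere:
  assumes "filterlim x at_infinity F"
  shows "((\<lambda>k. Some (x k) :: riemann_sphere) \<longlongrightarrow> None) F"
proof (rule topological_tendstoI)
  fix U :: "riemann_sphere set" assume "open U" "None \<in> U"
  then have "bounded (- (Some -` U))"
    by (auto simp: open_sphere_iff compact_imp_bounded)
  then obtain M where "M > 0" and M: "\<And>z. Some z \<notin> U \<Longrightarrow> norm z \<le> M"
    by (auto simp: bounded_pos)
  then have "eventually (\<lambda>k. M + 1 \<le> norm (x k)) F"
    using assms by (simp add: filterlim_at_infinity[of 0])
  then show "eventually (\<lambda>k. Some (x k) \<in> U) F"
    by eventually_elim (use M in force)
qed

lemma bounded_imp_not_tendsto_infinity:
  assumes "bounded S" "\<And>k. x k \<in> S"
  shows "\<not> (\<lambda>k. Some (x k) :: riemann_sphere) \<longlonglongrightarrow> None"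
proof
  assume lim: "(\<lambda>k. Some (x k) :: riemann_sphere) \<longlonglongrightarrow> None"
  obtain M where M: "\<And>z. z \<in> S \<Longrightarrow> norm z \<le> M"
    using assms by (auto simp: bounded_iff)
  have "open (insert None (Some ` (- cball 0 M)) :: riemann_sphere set)"
    by (rule open_insert_None) auto
  then have "eventually (\<lambda>k. Some (x k) \<in> insert None (Some ` (- cball 0 M))) sequentially"
    by (rule topological_tendstoD[OF lim]) auto
  then obtain k where "x k \<notin> cball 0 M"
    by (auto simp: eventually_sequentially)
  with M[OF assms(2)[of k]] show False by simp
qed

lemma open_sphere_exterior: "open (sphere_exterior R)"
  unfolding sphere_exterior_def
proof (rule open_insert_None)
  show "open {z::complex. R < norm z}"
    by (intro open_Collect_less continuous_intros)
  have "- {z::complex. R < norm z} = cball 0 R" by auto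
  then show "bounded (- {z::complex. R < norm z})" by simp
qed

section \<open>Laurent expansion of the Riemann map at infinity\<close>

text \<open>The hypothesis leaves out the origin because a Laurent expansion determines only the values
at \<open>x = 1 / z\<close> for finite \<open>z\<close>.\<close>

lemma power_series_zero:
  fixes d :: "nat \<Rightarrow> complex"
  assumes "\<And>x. x \<noteq> 0 \<Longrightarrow> norm x < 1 \<Longrightarrow> (\<lambda>n. d n * x ^ n) sums 0"
  shows "d n = 0"
proof (induction n rule: less_induct)
  case (less n)
  have "(\<lambda>k. d (k + n) * x ^ k) sums 0" if x: "x \<noteq> 0" "norm x < 1" for x
  proof -
    have "(\<lambda>k. d (k + n) * x ^ (k + n)) sums 0"
      using sums_split_initial_segment[OF assms[OF x], of n] less by simp
    then have "(\<lambda>k. d (k + n) * x ^ (k + n) * inverse (x ^ n)) sums (0 * inverse (x ^ n))"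
      by (rule sums_mult2)
    then show ?thesis using x by (simp add: power_add field_simps)
  qed
  then have "((\<lambda>x::complex. 0) \<longlongrightarrow> d (0 + n)) (at 0)"
    by (intro powser_limit_0_strong[of 1 "\<lambda>k. d (k + n)"]) auto
  then show ?case
    by (metis LIM_const_eq add_0)
qed

text \<open>In the coordinates \<open>1 / z\<close> on both sides, \<open>f\<close> becomes an injective holomorphic function \<open>h\<close> fixing
the origin, so \<open>h\<close> has nonzero derivative there. Hence \<open>x / h x\<close>, which is the required \<open>\<kappa>\<close> off the
origin, has a nonzero limit and the singularity is removable.\<close>

lemma exterior_map_expansion:
  assumes inj: "inj_on f (sphere_exterior 1)" and hol: "sphere_holomorphic_on f (sphere_exterior 1)"
    and inf: "f None = None"
  obtains \<kappa> where "\<kappa> holomorphic_on ball 0 1" "\<kappa> 0 \<noteq> 0"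
    "\<And>w. 1 < norm w \<Longrightarrow> f (Some w) = Some (w * \<kappa> (inverse w))"
proof -
  define g where "g w = the (f (Some w))" for w
  define h where "h x = the (sphere_inverse (f (sphere_inverse (Some x))))" for x
  have Some_ext: "Some w \<in> sphere_exterior 1 \<longleftrightarrow> 1 < norm w" for w
    by (auto simp: sphere_exterior_def)
  have inf_ext: "None \<in> sphere_exterior 1"
    by (auto simp: sphere_exterior_def)
  have f: "f (Some w) = Some (g w)" if "1 < norm w" for w
    using inj_onD[OF inj, of "Some w" None] that inf inf_ext Some_ext[of w]
    by (cases "f (Some w)") (auto simp: g_def)
  have "g holomorphic_on {w. id (Some w) \<in> sphere_exterior 1 \<and> id (f (id (Some w))) \<noteq> None}"
    using hol unfolding sphere_holomorphic_on_def g_def by fastforce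
  then have holg: "g holomorphic_on {w. 1 < norm w}"
    by (rule holomorphic_on_subset) (use f Some_ext in auto)
  have g_inj: "v = w" if "g v = g w" "1 < norm v" "1 < norm w" for v w
    using inj_onD[OF inj, of "Some v" "Some w"] that f Some_ext by auto
  \<comment> \<open>The points removed from the disk are the poles of \<open>h\<close>; by injectivity there is at most one.\<close>
  define D where "D = ball 0 1 - {x. x \<noteq> 0 \<and> norm x < 1 \<and> g (inverse x) = 0}"
  have norm_inv: "1 < norm (inverse x)" if "x \<noteq> 0" "norm x < 1" for x :: complex
    using that norm_inverse_less_iff(2)[of 1 x] by simp
  have "h holomorphic_on {x. sphere_inverse (Some x) \<in> sphere_exterior 1 \<and>
           sphere_inverse (f (sphere_inverse (Some x))) \<noteq> None}"
    using hol unfolding sphere_holomorphic_on_def h_def by fastforce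
  then have holh: "h holomorphic_on D"
  proof (rule holomorphic_on_subset, intro subsetI CollectI conjI)
    fix x assume x: "x \<in> D"
    show "sphere_inverse (Some x) \<in> sphere_exterior 1"
      using x inf_ext norm_inv[of x] Some_ext by (auto simp: sphere_inverse_def D_def)
    show "sphere_inverse (f (sphere_inverse (Some x))) \<noteq> None"
      using x norm_inv[of x] f[of "inverse x"] inf
      by (auto simp: sphere_inverse_def D_def split: if_splits)
  qed
  have hx: "h x = inverse (g (inverse x))" "g (inverse x) \<noteq> 0" if "x \<in> D" "x \<noteq> 0" for x
    using that norm_inv[of x] f[of "inverse x"] by (auto simp: h_def sphere_inverse_def D_def)
  have h0: "h 0 = 0"
    by (simp add: h_def sphere_inverse_def inf)
  have "finite {x. x \<noteq> 0 \<and> norm x < 1 \<and> g (inverse x) = 0}" (is "finite ?Z")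
  proof (cases "?Z = {}")
    case False
    then obtain x where x: "x \<in> ?Z" by blast
    have "?Z \<subseteq> {x}"
    proof
      fix y assume "y \<in> ?Z"
      with x g_inj[of "inverse x" "inverse y"] norm_inv[of x] norm_inv[of y]
      have "inverse x = inverse y" by auto
      then show "y \<in> {x}" by simp
    qed
    then show ?thesis using finite_subset by blast
  qed (auto simp only: finite.emptyI)
  then have oD: "open D"
    unfolding D_def by (intro open_Diff open_ball finite_imp_closed)
  have D0: "0 \<in> D" by (simp add: D_def)
  have "inj_on h D"
  proof (rule inj_onI)
    fix x y assume xy: "x \<in> D" "y \<in> D" "h x = h y"
    show "x = y"
    proof (cases "x = 0 \<or> y = 0")
      case True
      then show ?thesis using xy hx h0
        by (metis inverse_nonzero_iff_nonzero)
    next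
      case False
      then have "g (inverse x) = g (inverse y)"
        using xy hx by auto
      then have "inverse x = inverse y"
        by (rule g_inj) (use norm_inv False xy in \<open>auto simp: D_def\<close>)
      then show ?thesis by simp
    qed
  qed
  then have dh: "deriv h 0 \<noteq> 0"
    using holomorphic_injective_imp_regular[OF holh oD] D0 by blast
  define \<kappa> where "\<kappa> x = (if x = 0 then inverse (deriv h 0) else x * g (inverse x))" for x
  show thesis
  proof
    show "\<kappa> holomorphic_on ball 0 1"
    proof (rule no_isolated_singularity'[where K = "{0}"])
      have "(\<lambda>x. x * (g \<circ> inverse) x) holomorphic_on ball 0 1 - {0}"
        using norm_inv
        by (intro holomorphic_intros holomorphic_on_compose_gen[OF _ holg]) auto
      then show "\<kappa> holomorphic_on ball 0 1 - {0}"
        by (rule holomorphic_transform) (auto simp: \<kappa>_def)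
      have "(h has_field_derivative deriv h 0) (at 0)"
        using holomorphic_derivI[OF holh oD D0] .
      then have "((\<lambda>x. h x / x) \<longlongrightarrow> deriv h 0) (at 0)"
        by (simp add: has_field_derivative_iff h0)
      then have "((\<lambda>x. inverse (h x / x)) \<longlongrightarrow> inverse (deriv h 0)) (at 0)"
        using dh by (rule tendsto_inverse)
      moreover have "eventually (\<lambda>x. inverse (h x / x) = \<kappa> x) (at 0)"
        using eventually_at_in_open'[OF oD D0] eventually_neq_at_within[of 0]
        by eventually_elim (auto simp: hx \<kappa>_def field_simps)
      ultimately have "(\<kappa> \<longlongrightarrow> \<kappa> 0) (at 0)"
        by (simp add: \<kappa>_def[of 0] filterlim_cong[OF refl refl] tendsto_cong)
      then show "(\<kappa> \<longlongrightarrow> \<kappa> z) (at z within ball 0 1)" if "z \<in> {0}" for z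
        using that tendsto_within_subset by blast
    qed auto
    show "\<kappa> 0 \<noteq> 0" using dh by (simp add: \<kappa>_def)
    fix w :: complex assume "1 < norm w"
    moreover from this have "w \<noteq> 0" by auto
    ultimately show "f (Some w) = Some (w * \<kappa> (inverse w))"
      using f[of w] by (simp add: \<kappa>_def)
  qed
qed

lemma rescaled_map_expansion:
  assumes iso: "conformal_isomorphism f (sphere_exterior 1) U"
    and inf: "f None = None" and e: "\<epsilon> > 0"
  obtains \<kappa> where "exterior_map \<kappa> (1 + \<epsilon>)"
    "\<And>w. 1 / (1 + \<epsilon>) < norm w \<Longrightarrow> rescaled_map f \<epsilon> (Some w) = Some (exterior_map.phi \<kappa> w)"
    "leading_coeff (rescaled_map f \<epsilon>) = \<kappa> 0"
    "U = insert None (Some ` exterior_map.phi_ext \<kappa> (1 / (1 + \<epsilon>)))"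
proof -
  have bij: "bij_betw f (sphere_exterior 1) U" and hol: "sphere_holomorphic_on f (sphere_exterior 1)"
    using iso by (auto simp: conformal_isomorphism_def)
  note inj = bij_betw_imp_inj_on[OF bij]
  obtain \<kappa>' where k': "\<kappa>' holomorphic_on ball 0 1" "\<kappa>' 0 \<noteq> 0"
    "\<And>w. 1 < norm w \<Longrightarrow> f (Some w) = Some (w * \<kappa>' (inverse w))"
    using exterior_map_expansion[OF inj hol inf] by blast
  define \<rho> where "\<rho> = 1 + \<epsilon>"
  have rho: "\<rho> > 1" using e by (simp add: \<rho>_def)
  define \<kappa> where "\<kappa> x = of_real \<rho> * \<kappa>' (x / of_real \<rho>)" for x
  have f: "f (Some (of_real \<rho> * w)) = Some (w * \<kappa> (inverse w))" if w: "1 / \<rho> < norm w" for w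
  proof -
    have "1 < norm (of_real \<rho> * w)"
      using w rho by (simp add: norm_mult field_simps)
    then show ?thesis
      using k'(3)[of "of_real \<rho> * w"] rho by (simp add: \<kappa>_def field_simps)
  qed
  have ext: "Some (of_real \<rho> * w) \<in> sphere_exterior 1" if w: "1 / \<rho> < norm w" for w
    using w rho by (simp add: sphere_exterior_def norm_mult field_simps)
  have k: "exterior_map \<kappa> \<rho>"
  proof
    have "(\<kappa>' \<circ> (\<lambda>x. x / of_real \<rho>)) holomorphic_on ball 0 \<rho>"
      using rho
      by (intro holomorphic_on_compose_gen[OF _ k'(1)] holomorphic_intros) (auto simp: norm_divide)
    then show "\<kappa> holomorphic_on ball 0 \<rho>"
      unfolding \<kappa>_def[abs_def] o_def by (intro holomorphic_intros)
    show "\<kappa> 0 \<noteq> 0" using k' rho by (simp add: \<kappa>_def)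
    show "inj_on (\<lambda>w. w * \<kappa> (inverse w)) {w. 1 / \<rho> < norm w}"
    proof (rule inj_onI)
      fix v w assume "v \<in> {w. 1 / \<rho> < norm w}" "w \<in> {w. 1 / \<rho> < norm w}"
         "v * \<kappa> (inverse v) = w * \<kappa> (inverse w)"
      then show "v = w"
        using inj_onD[OF inj _ ext ext, of v w] f[of v] f[of w] rho by simp
    qed
  qed (rule rho)
  interpret exterior_map \<kappa> \<rho> by (rule k)
  have resc: "rescaled_map f \<epsilon> (Some w) = Some (phi w)" if w: "1 / \<rho> < norm w" for w
    using f[OF w] by (simp add: rescaled_map_def phi_def \<rho>_def)
  show thesis
  proof
    show "exterior_map \<kappa> (1 + \<epsilon>)" using k by (simp add: \<rho>_def)
    show "rescaled_map f \<epsilon> (Some w) = Some (phi w)" if "1 / (1 + \<epsilon>) < norm w" for w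
      using resc[of w] that by (simp add: \<rho>_def)
    show "U = insert None (Some ` phi_ext (1 / (1 + \<epsilon>)))"
    proof -
      have "sphere_exterior 1 = insert None ((\<lambda>w. Some (of_real \<rho> * w)) ` {w. 1 / \<rho> < norm w})"
      proof (intro equalityI subsetI)
        fix p assume p: "p \<in> sphere_exterior 1"
        show "p \<in> insert None ((\<lambda>w. Some (of_real \<rho> * w)) ` {w. 1 / \<rho> < norm w})"
        proof (cases p)
          case (Some w)
          then have "Some (of_real \<rho> * (w / of_real \<rho>)) = p" "1 / \<rho> < norm (w / of_real \<rho>)"
            using p rho by (auto simp: sphere_exterior_def norm_divide divide_strict_right_mono)
          then show ?thesis by blast
        qed simp
      qed (use ext in \<open>auto simp: sphere_exterior_def\<close>)
      then have "U = insert None (f ` (\<lambda>w. Some (of_real \<rho> * w)) ` {w. 1 / \<rho> < norm w})"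
        using bij_betw_imp_surj_on[OF bij] inf by simp
      also have "f ` (\<lambda>w. Some (of_real \<rho> * w)) ` {w. 1 / \<rho> < norm w} = Some ` phi_ext (1 / \<rho>)"
        unfolding phi_ext_def image_image by (intro image_cong refl) (use f in \<open>simp add: phi_def\<close>)
      finally show ?thesis by (simp add: \<rho>_def)
    qed
    define a where "a k = (deriv ^^ k) \<kappa> 0 / fact k" for k
    have pow: "z powi (1 - int k) = z * inverse z ^ k" if "z \<noteq> 0" for z :: complex and k
      using that by (simp add: power_int_diff power_inverse divide_inverse)
    have a: "(\<lambda>k. a k * z powi (1 - int k)) sums the (rescaled_map f \<epsilon> (Some z))"
      if z: "norm z \<ge> 1" for z
    proof -
      have z0: "1 / \<rho> < norm z" using z inverse_rho(2) by linarith
      have "z \<noteq> 0" using z by auto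
      have "(\<lambda>k. a k * (inverse z - 0) ^ k) sums \<kappa> (inverse z)"
        unfolding a_def using norm_inverse_less[OF z0]
        by (intro holomorphic_power_series[OF kappa_holomorphic]) auto
      then have "(\<lambda>k. z * (a k * (inverse z - 0) ^ k)) sums (z * \<kappa> (inverse z))"
        by (rule sums_mult)
      then show ?thesis
        using z0 \<open>z \<noteq> 0\<close> by (simp add: resc phi_def pow mult_ac)
    qed
    have "laurent_coeffs (rescaled_map f \<epsilon>) = a"
      unfolding laurent_coeffs_def
    proof (rule the_equality)
      show "\<forall>z. 1 \<le> norm z \<longrightarrow> (\<lambda>k. a k * z powi (1 - int k)) sums the (rescaled_map f \<epsilon> (Some z))"
        using a by blast
      fix b assume b: "\<forall>z. 1 \<le> norm z \<longrightarrow> (\<lambda>k. b k * z powi (1 - int k)) sums the (rescaled_map f \<epsilon> (Some z))"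
      have "b k - a k = 0" for k
      proof (rule power_series_zero[of "\<lambda>k. b k - a k"])
        fix x :: complex assume x: "x \<noteq> 0" "norm x < 1"
        define z where "z = inverse x"
        have z: "1 \<le> norm z" "z \<noteq> 0" "x = inverse z"
          using x norm_inverse_less_iff(2)[of 1 x] by (auto simp: z_def)
        have "(\<lambda>k. b k * z powi (1 - int k) - a k * z powi (1 - int k)) sums
           (the (rescaled_map f \<epsilon> (Some z)) - the (rescaled_map f \<epsilon> (Some z)))"
          by (intro sums_diff a z(1) b[rule_format])
        then have "(\<lambda>k. z * ((b k - a k) * x ^ k)) sums 0"
          using z by (simp add: pow algebra_simps)
        then show "(\<lambda>k. (b k - a k) * x ^ k) sums 0"
          using z(2) sums_mult_iff[of z "\<lambda>k. (b k - a k) * x ^ k" 0] by simp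
      qed
      then show "b = a" by (simp add: fun_eq_iff)
    qed
    then show "leading_coeff (rescaled_map f \<epsilon>) = \<kappa> 0"
      by (simp add: leading_coeff_def a_def)
  qed
qed

section \<open>The core curve separates the two complementary disks\<close>

context exterior_map
begin

text \<open>The exterior image is connected and unbounded while the remaining part of the complement of
the curve is bounded; both are open. This identifies the inside of the curve and so provides,
through the Jordan curve theorem, simply connected neighbourhoods of the complement of the image
of \<open>phi\<close>.\<close>

lemma phi_circle:
  assumes r: "1 / \<rho> < r"
  defines "c \<equiv> phi \<circ> circlepath 0 r"
  shows "simple_path c" "pathfinish c = pathstart c"
    "inside (path_image c) = - phi ` {w. r \<le> norm w}"
proof -
  have r0: "0 < r" using r inverse_rho by linarith
  have pc: "path_image c = phi ` sphere 0 r"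
    using r0 by (simp add: c_def path_image_compose)
  have sub: "sphere 0 r \<subseteq> {w. 1 / \<rho> < norm w}" using r by auto
  have simple: "simple_path (circlepath 0 r)"
    using r0 by (simp add: simple_path_circlepath)
  show "simple_path c"
    unfolding simple_path_def
  proof
    show "path c"
      unfolding c_def using r0
      by (intro path_continuous_image continuous_on_subset[OF phi_continuous[OF r]]) auto
    have "circlepath 0 r x \<in> {w. 1 / \<rho> < norm w}" if "x \<in> {0..1}" for x
    proof -
      have "circlepath 0 r x \<in> path_image (circlepath 0 r)"
        using that unfolding path_image_def by blast
      with sub r0 show ?thesis by auto
    qed
    then show "loop_free c"
      using simple phi_inj unfolding simple_path_def loop_free_def c_def o_def inj_on_def by blast
  qed
  show "pathfinish c = pathstart c"
    by (simp add: c_def pathfinish_compose pathstart_compose)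
  define O1 where "O1 = phi_ext r"
  define O2 where "O2 = - phi ` {w. r \<le> norm w}"
  have op: "open O1" "open O2"
    using open_phi_ext[of r] closed_phi_image[OF r] r by (auto simp: O1_def O2_def open_Compl)
  have "{w::complex. r \<le> norm w} = {w. r < norm w} \<union> sphere 0 r" by auto
  then have split: "phi ` {w. r \<le> norm w} = phi_ext r \<union> phi ` sphere 0 r"
    unfolding phi_ext_def by (metis image_Un)
  have disj: "phi_ext r \<inter> phi ` sphere 0 r = {}"
    using phi_image_eq_iff[of r] r by auto
  have conn: "connected O1"
    unfolding O1_def phi_ext_def using r
    by (intro connected_continuous_image connected_exterior continuous_on_subset[OF phi_continuous[OF r]]) auto
  have "bounded (- O1)"
    using bounded_compl_phi_ext[OF r] by (simp add: O1_def)
  then have unb: "\<not> bounded O1"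
    using bounded_Un[of O1 "- O1"] by (auto simp: not_bounded_UNIV)
  show "inside (path_image c) = - phi ` {w. r \<le> norm w}"
  proof (intro equalityI subsetI)
    fix z assume z: "z \<in> inside (path_image c)"
    show "z \<in> - phi ` {w. r \<le> norm w}"
    proof
      assume "z \<in> phi ` {w. r \<le> norm w}"
      then have "z \<in> O1"
        using z inside_no_overlap[of "path_image c"] unfolding split pc O1_def by blast
      then have "O1 \<subseteq> connected_component_set (- path_image c) z"
        using disj by (intro connected_component_maximal conn) (auto simp: O1_def pc)
      then have "bounded O1"
        using z bounded_subset by (auto simp: inside_def)
      with unb show False by simp
    qed
  next
    fix z assume z: "z \<in> - phi ` {w. r \<le> norm w}"
    define S where "S = connected_component_set (- path_image c) z"
    have zS: "z \<in> S"
      unfolding S_def using z split pc by (auto simp: connected_component_refl_eq)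
    have "S \<subseteq> O1 \<union> O2"
      using connected_component_subset[of "- path_image c" z] split pc by (auto simp: S_def O1_def O2_def)
    moreover have "O1 \<inter> O2 = {}" by (auto simp: O1_def O2_def phi_ext_def)
    moreover have "connected S" by (simp add: S_def)
    ultimately have "O1 \<inter> S = {} \<or> O2 \<inter> S = {}"
      using op unfolding connected_def by blast
    then have "S \<subseteq> O2"
      using z zS \<open>S \<subseteq> O1 \<union> O2\<close> by (auto simp: O2_def)
    moreover have "O2 \<subseteq> - phi_ext r" using split by (auto simp: O2_def)
    ultimately have "bounded S"
      using bounded_compl_phi_ext[OF r] bounded_subset by blast
    then show "z \<in> inside (path_image c)"
      using z split pc by (auto simp: inside_def S_def)
  qed
qed

definition sphere_ext :: "real \<Rightarrow> riemann_sphere set" where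
  "sphere_ext r = insert None (Some ` phi_ext r)"

lemma sphere_ext_mono: "r \<le> r' \<Longrightarrow> sphere_ext r' \<subseteq> sphere_ext r"
  by (auto simp: sphere_ext_def phi_ext_def)

lemma open_sphere_ext: "1 / \<rho> < r \<Longrightarrow> open (sphere_ext r)"
  unfolding sphere_ext_def
  by (intro open_insert_None open_phi_ext bounded_compl_phi_ext) auto

text \<open>The sphere is compact and the open sets \<open>sphere_ext r\<close> with \<open>a < r\<close> exhaust \<open>sphere_ext a\<close>.\<close>

lemma closed_subset_sphere_ext:
  assumes X: "closed X" "X \<subseteq> sphere_ext a" and a: "1 / \<rho> \<le> a"
  obtains r where "a < r" "X \<subseteq> sphere_ext r"
proof -
  have "X \<subseteq> (\<Union>r\<in>{a<..}. sphere_ext r)"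
  proof
    fix p assume "p \<in> X"
    with X consider "p = None" | w where "p = Some (phi w)" "a < norm w"
      by (auto simp: sphere_ext_def phi_ext_def)
    then show "p \<in> (\<Union>r\<in>{a<..}. sphere_ext r)"
    proof cases
      case 1
      then show ?thesis by (auto simp: sphere_ext_def intro: gt_ex)
    next
      case (2 w)
      then obtain r where "a < r" "r < norm w" using dense by blast
      with 2 show ?thesis by (auto simp: sphere_ext_def phi_ext_def)
    qed
  qed
  then obtain C where C: "C \<subseteq> {a<..}" "finite C" "X \<subseteq> (\<Union>r\<in>C. sphere_ext r)"
    using a by (rule_tac compactE_image[OF closed_imp_compact_sphere[OF X(1)], of "{a<..}" sphere_ext])
      (auto intro!: open_sphere_ext)
  \<comment> \<open>Inserting \<open>a + 1\<close> covers the case of an empty subcover.\<close>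
  define r where "r = Min (insert (a + 1) C)"
  have "sphere_ext q \<subseteq> sphere_ext r" if "q \<in> C" for q
    using that C(2) by (intro sphere_ext_mono) (auto simp: r_def)
  then have "X \<subseteq> sphere_ext r" using C(3) by blast
  moreover have "a < r"
    using C by (auto simp: r_def)
  ultimately show thesis using that by blast
qed

text \<open>Suppose that the whole complement of \<open>A\<close> lies on the unbounded side of \<open>\<gamma>\<close>. The closure of
that complement avoids \<open>\<gamma>\<close>, so it stays outside some curve \<open>c\<close>, the image of a circle of radius
\<open>r\<close> slightly larger than \<open>1 / \<rho>\<close>. The inside of \<open>c\<close> is then a simply connected subset of \<open>A\<close> that
contains \<open>\<gamma>\<close>, and so \<open>\<gamma>\<close> is null-homotopic in \<open>A\<close>. By injectivity on fundamental groups it would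
be null-homotopic in itself, which contradicts its winding number around points inside it.
Working with \<open>c\<close> in place of \<open>\<gamma>\<close> avoids any statement about the boundary behaviour of Riemann
maps.\<close>

lemma complement_not_on_unbounded_side:
  assumes core: "core_curve A \<gamma>" and inf: "None \<notin> A"
    and U: "connected_component_set (- \<gamma>) None = sphere_ext (1 / \<rho>)"
  shows "\<not> - A \<subseteq> sphere_ext (1 / \<rho>)"
proof
  assume sub: "- A \<subseteq> sphere_ext (1 / \<rho>)"
  have gA: "\<gamma> \<subseteq> interior A" and inj: "pi1_injective \<gamma> A" and jc: "jordan_curve \<gamma>"
    using core by (auto simp: core_curve_def)
  have gA': "\<gamma> \<subseteq> A" using gA interior_subset by blast
  \<comment> \<open>A component of the complement of \<open>\<gamma>\<close> absorbs its closure apart from \<open>\<gamma>\<close> itself.\<close>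
  define T where "T = sphere_ext (1 / \<rho>) \<union> (closure (sphere_ext (1 / \<rho>)) - \<gamma>)"
  have subT: "sphere_ext (1 / \<rho>) \<subseteq> - \<gamma>"
    using connected_component_subset[of "- \<gamma>" None] by (simp add: U)
  have "connected (sphere_ext (1 / \<rho>))"
    using connected_connected_component[of "- \<gamma>" None] by (simp add: U)
  then have "connected T"
    by (rule connected_intermediate_closure) (use closure_subset in \<open>auto simp: T_def\<close>)
  then have "T \<subseteq> connected_component_set (- \<gamma>) None"
    by (rule connected_component_maximal[rotated]) (use subT in \<open>auto simp: T_def sphere_ext_def\<close>)
  then have "closure (sphere_ext (1 / \<rho>)) - \<gamma> \<subseteq> sphere_ext (1 / \<rho>)"
    unfolding U T_def by blast
  moreover have "closure (- A) \<subseteq> closure (sphere_ext (1 / \<rho>)) - \<gamma>"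
    using gA closure_mono[OF sub] by (auto simp: closure_interior)
  ultimately have "closure (- A) \<subseteq> sphere_ext (1 / \<rho>)" by blast
  then obtain r where r: "1 / \<rho> < r" "closure (- A) \<subseteq> sphere_ext r"
    using closed_subset_sphere_ext[of "closure (- A)" "1 / \<rho>"] by auto
  define c where "c = phi \<circ> circlepath 0 r"
  define V where "V = inside (path_image c)"
  have V: "V = - phi ` {w. r \<le> norm w}"
    using phi_circle(3)[OF r(1)] by (simp add: V_def c_def)
  have scV: "simply_connected V"
    unfolding V_def c_def by (intro simply_connected_inside_simple_path phi_circle r)
  have VA: "Some ` V \<subseteq> A"
  proof safe
    fix z assume "z \<in> V"
    then have "Some z \<notin> sphere_ext r"
      by (auto simp: V sphere_ext_def phi_ext_def)
    then show "Some z \<in> A"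
      using r(2) closure_subset by blast
  qed
  obtain g where g: "simple_path g" "pathfinish g = pathstart g" "\<gamma> = path_image g"
    using jc by (auto simp: jordan_curve_def)
  have cont: "continuous_on \<gamma> the"
    using gA' inf by (intro continuous_on_the) auto
  define p where "p = the \<circ> g"
  define q where "q = linepath (pathstart p) (pathstart p)"
  have Some_p: "Some (p x) = g x" if "x \<in> {0..1}" for x
  proof -
    have "g x \<in> \<gamma>" using that g(3) by (simp add: path_image_def)
    then have "g x \<in> A" using gA' by blast
    then have "g x \<noteq> None" using inf by metis
    then show ?thesis by (simp add: p_def)
  qed
  have p: "path p"
    unfolding p_def using g cont by (intro path_continuous_image) (auto simp: simple_path_def)
  have simple: "simple_path p"
    unfolding simple_path_def
  proof (rule conjI[OF p])
    show "loop_free p"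
      using g(1) unfolding simple_path_def loop_free_def by (metis Some_p)
  qed
  have close: "pathfinish p = pathstart p"
    using g(2) by (simp add: p_def pathfinish_compose pathstart_compose)
  have img: "Some ` path_image p = \<gamma>"
    unfolding g(3) path_image_def image_image by (intro image_cong refl) (use Some_p in auto)
  have pV: "path_image p \<subseteq> V"
  proof
    fix z assume "z \<in> path_image p"
    then have "Some z \<in> \<gamma>" using img by blast
    then have "z \<notin> phi_ext (1 / \<rho>)" using subT by (auto simp: sphere_ext_def)
    then show "z \<in> V" using r(1) by (auto simp: V phi_ext_def)
  qed
  have start: "pathstart p \<in> path_image p" by (auto simp: path_image_def pathstart_def)
  have "path q" "path_image q \<subseteq> V" "pathstart q = pathstart p" "pathfinish q = pathfinish p"
    using pV start close by (auto simp: q_def)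
  then have "homotopic_paths V p q"
    using scV p pV unfolding simply_connected_eq_homotopic_paths by metis
  then have "homotopic_paths (Some ` V) (Some \<circ> p) (Some \<circ> q)"
    by (rule homotopic_paths_continuous_image) (auto intro: continuous_on_Some)
  then have "homotopic_paths A (Some \<circ> p) (Some \<circ> q)"
    using VA homotopic_paths_subset by blast
  moreover have "path (Some \<circ> p)" "path (Some \<circ> q)"
    using p by (auto simp: q_def intro!: path_continuous_image continuous_on_Some)
  moreover have "path_image (Some \<circ> p) \<subseteq> \<gamma>" "path_image (Some \<circ> q) \<subseteq> \<gamma>"
    using img start by (auto simp: path_image_compose q_def)
  ultimately have "homotopic_paths \<gamma> (Some \<circ> p) (Some \<circ> q)"
    using inj close unfolding pi1_injective_def
    by (auto simp: pathfinish_compose pathstart_compose q_def)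
  then have "homotopic_paths (path_image p) (the \<circ> (Some \<circ> p)) (the \<circ> (Some \<circ> q))"
    by (rule homotopic_paths_continuous_image[OF _ cont]) (use img in auto)
  then have hom: "homotopic_paths (path_image p) p q"
    by (simp add: o_def)
  obtain z where z: "z \<in> inside (path_image p)"
    using Jordan_inside_outside[OF simple close] by blast
  then have zp: "z \<notin> path_image p"
    using inside_no_overlap[of "path_image p"] by blast
  have "winding_number p z = winding_number q z"
    by (rule winding_number_homotopic_paths[OF homotopic_paths_subset[OF hom]]) (use zp in auto)
  also have "\<dots> = 0"
    unfolding q_def using zp start by (intro winding_number_trivial) auto
  finally have "winding_number p z = 0" .
  moreover have "winding_number p z \<noteq> 0"
    using simple_closed_path_winding_number_inside[OF simple] z by (metis zero_neq_neg_one zero_neq_one)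
  ultimately show False by simp
qed

text \<open>The inner disk is connected and avoids \<open>\<gamma>\<close>, so it lies on one side; if this were the unbounded
side, the whole complement of \<open>A\<close> would lie there.\<close>

lemma core_curve_separates:
  assumes core: "core_curve A \<gamma>" and inf: "None \<notin> A" and conn: "connected (inner_disk A)"
    and U: "connected_component_set (- \<gamma>) None = sphere_ext (1 / \<rho>)"
  shows "inner_disk A \<inter> sphere_ext (1 / \<rho>) = {}"
proof (rule ccontr)
  assume "\<not> ?thesis"
  then obtain p where p: "p \<in> inner_disk A" "p \<in> sphere_ext (1 / \<rho>)" by blast
  have gA: "- A \<subseteq> - \<gamma>"
    using core interior_subset by (auto simp: core_curve_def)
  have "connected_component_set (- \<gamma>) p = sphere_ext (1 / \<rho>)"
    using connected_component_eq[of p "- \<gamma>" None] p(2) U by simp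
  moreover have "inner_disk A \<subseteq> connected_component_set (- \<gamma>) p"
    using p gA by (intro connected_component_maximal conn) (auto simp: inner_disk_def)
  moreover have "outer_disk A \<subseteq> sphere_ext (1 / \<rho>)"
    unfolding outer_disk_def U[symmetric] by (rule connected_component_mono[OF gA])
  ultimately have "- A \<subseteq> sphere_ext (1 / \<rho>)"
    by (auto simp: inner_disk_def)
  then show False
    using complement_not_on_unbounded_side[OF core inf U] by simp
qed

text \<open>The closed outer disk is connected, contains infinity, and avoids the image of the unit
circle, which is interior to \<open>A\<close>. Hence it lies in the exterior image of that circle, and by
compactness a little further out.\<close>

lemma closure_outer_disk_subset:
  assumes inf: "None \<notin> A" and C: "Some ` phi ` sphere 0 1 \<subseteq> interior A"
  obtains d where "1 < d" "closure (outer_disk A) \<subseteq> sphere_ext d"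
proof -
  define S where "S = closure (outer_disk A)"
  define O2 :: "riemann_sphere set" where "O2 = Some ` (- phi ` {w. 1 \<le> norm w})"
  have one: "1 / \<rho> < 1" using inverse_rho by simp
  have "S \<subseteq> closure (- A)"
    unfolding S_def outer_disk_def by (intro closure_mono connected_component_subset)
  then have "S \<inter> interior A = {}" by (auto simp: closure_interior)
  then have "S \<subseteq> - Some ` phi ` sphere 0 1" using C by blast
  also have "\<dots> \<subseteq> sphere_ext 1 \<union> O2"
  proof
    fix p assume p: "p \<in> - Some ` phi ` sphere (0::complex) 1"
    show "p \<in> sphere_ext 1 \<union> O2"
    proof (cases p)
      case (Some z)
      show ?thesis
      proof (cases "z \<in> phi ` {w. 1 \<le> norm w}")
        case True
        then obtain w where w: "z = phi w" "1 \<le> norm w" by blast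
        with p Some have "norm w \<noteq> 1" by auto
        with w Some show ?thesis by (auto simp: sphere_ext_def phi_ext_def)
      qed (use Some in \<open>auto simp: O2_def\<close>)
    qed (auto simp: sphere_ext_def)
  qed
  finally have "S \<subseteq> sphere_ext 1 \<union> O2" .
  moreover have "sphere_ext 1 \<inter> O2 = {}"
    by (auto simp: sphere_ext_def phi_ext_def O2_def)
  moreover have "open (sphere_ext 1)" "open O2"
    using closed_phi_image[OF one] one
    by (auto simp: O2_def intro!: open_sphere_ext open_Some_image open_Compl)
  moreover have "connected S"
    unfolding S_def outer_disk_def
    by (rule connected_intermediate_closure[OF connected_connected_component closure_subset]) simp
  ultimately have "sphere_ext 1 \<inter> S = {} \<or> O2 \<inter> S = {}"
    unfolding connected_def by blast
  moreover have "None \<in> S"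
    unfolding S_def outer_disk_def using inf closure_subset[of "connected_component_set (- A) None"]
    by (auto simp: connected_component_refl_eq)
  then have "None \<in> sphere_ext 1 \<inter> S" by (auto simp: sphere_ext_def)
  ultimately have "S \<subseteq> sphere_ext 1"
    using \<open>S \<subseteq> sphere_ext 1 \<union> O2\<close> by blast
  then show thesis
    using closed_subset_sphere_ext[of S 1] one that unfolding S_def by auto
qed

end

section \<open>The dynamics when the inner disk contains the origin\<close>

lemma sphere_poly_iterate: "(sphere_poly p ^^ k) (Some z) = Some ((poly p ^^ k) z)"
  by (induction k) (simp_all add: sphere_poly_def)

lemma sphere_poly_iterate_infinity: "(sphere_poly p ^^ k) None = None"
  by (induction k) (simp_all add: sphere_poly_def)

lemma closed_annulus_bounded:
  assumes "A \<in> closed_annuli" shows "None \<notin> A"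
proof -
  obtain U R where U: "U \<inter> sphere_exterior R = {}" "A = closure U"
    using assms by (auto simp: closed_annuli_def)
  then have "A \<inter> sphere_exterior R = {}"
    using open_Int_closure_eq_empty[OF open_sphere_exterior[of R], of U] by blast
  then show ?thesis by (auto simp: sphere_exterior_def)
qed

text \<open>Closures and interiors occur here because this stronger form yields at once all four assertions
about the Julia set, by \<open>julia_in_annulus\<close> below.\<close>

lemma annulus_poly_separates_disks:
  assumes A: "A \<in> closed_annuli" and ch: "admissible_choice A \<gamma> f \<epsilon>"
    and 0: "Some 0 \<in> inner_disk A"
  shows "\<exists>N. \<forall>n\<ge>N. let F = sphere_poly (annulus_poly (rescaled_map f \<epsilon>) n) in
    closure (inner_disk A) \<subseteq> interior (filled_julia F) \<and>
    closure (outer_disk A) \<subseteq> interior (basin_infinity F)"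
proof -
  define \<rho> where "\<rho> = 1 + \<epsilon>"
  have core: "core_curve A \<gamma>" and e: "\<epsilon> > 0" and finf: "f None = None"
    and iso: "conformal_isomorphism f (sphere_exterior 1) (connected_component_set (- \<gamma>) None)"
    and fC: "f ` Some ` {z. norm z = 1 + \<epsilon>} \<subseteq> interior A"
    using ch by (auto simp: admissible_choice_def)
  obtain \<kappa> where k: "exterior_map \<kappa> \<rho>"
    and resc: "\<And>w. 1 / \<rho> < norm w \<Longrightarrow> rescaled_map f \<epsilon> (Some w) = Some (exterior_map.phi \<kappa> w)"
    and lead: "leading_coeff (rescaled_map f \<epsilon>) = \<kappa> 0"
    and comp: "connected_component_set (- \<gamma>) None = insert None (Some ` exterior_map.phi_ext \<kappa> (1 / \<rho>))"
    using rescaled_map_expansion[OF iso finf e] unfolding \<rho>_def by metis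
  interpret exterior_map \<kappa> \<rho> by (rule k)
  have inf: "None \<notin> A" by (rule closed_annulus_bounded[OF A])
  have U: "connected_component_set (- \<gamma>) None = sphere_ext (1 / \<rho>)"
    by (simp add: comp sphere_ext_def)
  have conn: "connected (inner_disk A)"
    using A homeomorphic_connectedness[of "inner_disk A" "ball (0::complex) 1"]
    by (simp add: closed_annuli_def)
  have sep: "inner_disk A \<inter> sphere_ext (1 / \<rho>) = {}"
    by (rule core_curve_separates[OF core inf conn U])
  have "Some ` phi ` sphere 0 1 \<subseteq> interior A"
  proof safe
    fix w :: complex assume "w \<in> sphere 0 1"
    then have w: "norm w = 1" by simp
    then have "Some (phi w) = f (Some (of_real (1 + \<epsilon>) * w))"
      using resc[of w] inverse_rho by (simp add: rescaled_map_def)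
    moreover have "norm (of_real (1 + \<epsilon>) * w) = 1 + \<epsilon>"
      using w e unfolding norm_mult norm_of_real by simp
    ultimately show "Some (phi w) \<in> interior A"
      using fC by auto
  qed
  then obtain d where d: "1 < d" "closure (outer_disk A) \<subseteq> sphere_ext d"
    using closure_outer_disk_subset[OF inf] by blast
  obtain s where s: "1 / \<rho> < s" "s < 1"
    using dense[OF inverse_rho(2)] by blast
  have zero: "0 \<notin> phi_ext (1 / \<rho>)"
    using 0 sep by (auto simp: sphere_ext_def)
  define V :: "riemann_sphere set" where "V = Some ` (- phi ` {w. s \<le> norm w})"
  have V_open: "open V"
    unfolding V_def using closed_phi_image[OF s(1)] by (intro open_Some_image) (simp add: open_Compl)
  have inner: "closure (inner_disk A) \<subseteq> V"
  proof -
    have "compact (- phi_ext (1 / \<rho>))"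
    proof -
      have "- phi_ext (1 / \<rho>) \<subseteq> - phi_ext s"
        using s by (auto simp: phi_ext_def)
      then show ?thesis
        using bounded_subset[OF bounded_compl_phi_ext[OF s(1)]] open_phi_ext[of "1 / \<rho>"]
        by (auto simp: compact_eq_bounded_closed closed_Compl)
    qed
    then have "closed (Some ` (- phi_ext (1 / \<rho>)) :: riemann_sphere set)"
      by (rule closed_Some_image)
    moreover have "inner_disk A \<subseteq> Some ` (- phi_ext (1 / \<rho>))"
    proof
      fix p assume "p \<in> inner_disk A"
      with sep have "p \<notin> sphere_ext (1 / \<rho>)" by blast
      then show "p \<in> Some ` (- phi_ext (1 / \<rho>))"
        by (cases p) (auto simp: sphere_ext_def)
    qed
    ultimately have "closure (inner_disk A) \<subseteq> Some ` (- phi_ext (1 / \<rho>))"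
      by (rule closure_minimal[rotated])
    also have "\<dots> \<subseteq> V"
      using s by (auto simp: V_def phi_ext_def)
    finally show ?thesis .
  qed
  obtain N1 where N1: "\<And>n z. n \<ge> N1 \<Longrightarrow> z \<notin> phi_ext s \<Longrightarrow> P n z \<notin> phi_ext s"
    using P_inside[OF s zero] by blast
  obtain N2 where N2: "\<And>n z. n \<ge> N2 \<Longrightarrow> z \<in> phi_ext d \<Longrightarrow> filterlim (\<lambda>k. (P n ^^ k) z) at_infinity sequentially"
    using P_outside[OF d(1) zero] by blast
  show ?thesis
  proof (intro exI[of _ "max N1 N2"] allI impI)
    fix n assume n: "max N1 N2 \<le> n"
    define F where "F = sphere_poly (annulus_poly (rescaled_map f \<epsilon>) n)"
    have node: "node (rescaled_map f \<epsilon>) k n = phi (unity_root n k)" for k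
      using resc[of "unity_root n k"] inverse_rho by (simp add: node_def flip: unity_root_def)
    have "poly (omega_poly (rescaled_map f \<epsilon>) n) z = omega n z" for z
      by (simp add: omega_poly_def lead node omega_def poly_prod prod_dividef field_simps)
    then have poly: "poly (annulus_poly (rescaled_map f \<epsilon>) n) = P n"
      by (auto simp: annulus_poly_def P_def)
    have F: "(F ^^ k) (Some z) = Some ((P n ^^ k) z)" for k z
      by (simp add: F_def sphere_poly_iterate poly)
    have "V \<subseteq> filled_julia F"
    proof
      fix p assume "p \<in> V"
      then obtain z where "p = Some z" "z \<notin> phi ` {w. s \<le> norm w}"
        by (auto simp: V_def)
      then have z: "p = Some z" "z \<notin> phi_ext s"
        by (auto simp: phi_ext_def)
      have iter: "(P n ^^ k) z \<in> - phi_ext s" for k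
        using N1[of n] n z by (induction k) auto
      then have "\<not> (\<lambda>k. Some ((P n ^^ k) z) :: riemann_sphere) \<longlonglongrightarrow> None"
        by (rule bounded_imp_not_tendsto_infinity[OF bounded_compl_phi_ext[OF s(1)]])
      then show "p \<in> filled_julia F"
        by (simp add: z filled_julia_def basin_infinity_def F)
    qed
    then have "closure (inner_disk A) \<subseteq> interior (filled_julia F)"
      using inner interior_maximal[OF _ V_open] by blast
    moreover have "sphere_ext d \<subseteq> basin_infinity F"
    proof
      fix p assume p: "p \<in> sphere_ext d"
      show "p \<in> basin_infinity F"
      proof (cases p)
        case None
        then show ?thesis
          by (simp add: basin_infinity_def F_def sphere_poly_iterate_infinity)
      next
        case (Some z)
        then have "z \<in> phi_ext d" using p by (auto simp: sphere_ext_def)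
        then show ?thesis
          using N2[of n z] n by (simp add: Some basin_infinity_def F tendsto_infinity_sphere)
      qed
    qed
    then have "closure (outer_disk A) \<subseteq> interior (basin_infinity F)"
      using d interior_maximal[OF _ open_sphere_ext[of d]] inverse_rho(2) by (meson less_trans order_trans)
    ultimately show "let F = sphere_poly (annulus_poly (rescaled_map f \<epsilon>) n) in
      closure (inner_disk A) \<subseteq> interior (filled_julia F) \<and>
      closure (outer_disk A) \<subseteq> interior (basin_infinity F)"
      by (simp add: F_def)
  qed
qed

section \<open>Translations of the sphere\<close>

lemma sphere_translation_inverse [simp]: "sphere_translation (- t) (sphere_translation t p) = p"
  "sphere_translation t (sphere_translation (- t) p) = p"
  by (cases p; simp add: sphere_translation_def)+

lemma sphere_translation_None [simp]: "sphere_translation t None = None"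
  by (simp add: sphere_translation_def)

lemma sphere_translation_comp [simp]:
  "sphere_translation t \<circ> sphere_translation (- t) = id"
  "sphere_translation (- t) \<circ> sphere_translation t = id"
  by (auto simp: fun_eq_iff)

lemma inv_sphere_translation: "inv (sphere_translation t) = sphere_translation (- t)"
  by (rule inv_unique_comp) auto

lemma sphere_translation_image_inverse [simp]:
  "sphere_translation (- t) ` sphere_translation t ` S = S"
  "sphere_translation t ` sphere_translation (- t) ` S = S"
  by (simp_all add: image_image)

lemma bij_sphere_translation: "bij (sphere_translation t)"
  by (rule o_bij[of "sphere_translation (- t)"]) auto

lemma continuous_sphere_translation: "continuous_on S (sphere_translation t)"
proof (rule continuous_on_subset)
  show "continuous_on UNIV (sphere_translation t)"
  proof (subst continuous_on_open_vimage, simp, intro allI impI)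
    fix B :: "riemann_sphere set" assume "open B"
    then have B: "open (Some -` B)" "None \<in> B \<Longrightarrow> compact (- (Some -` B))"
      by (auto simp: open_sphere_iff)
    have mem: "x \<in> (\<lambda>z. t + z) ` S \<longleftrightarrow> x - t \<in> S" for x S
      by (auto simp: image_iff intro!: bexI[of _ "x - t"])
    have eq: "Some -` (sphere_translation t -` B) = (\<lambda>z. t + z) ` (Some -` B)"
      by (auto simp: sphere_translation_def mem)
    have "- (Some -` (sphere_translation t -` B)) = (\<lambda>z. t + z) ` (- (Some -` B))"
      unfolding eq set_eq_iff Compl_iff mem by simp
    then show "open (sphere_translation t -` B \<inter> UNIV)"
      using B open_translation[of "Some -` B" t] compact_translation[of "- (Some -` B)" t]
      by (simp add: open_sphere_iff[of "sphere_translation t -` B"] eq)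
  qed
qed simp

lemma homeomorphic_map_sphere_translation:
  "homeomorphic_map euclidean euclidean (sphere_translation t)"
  unfolding homeomorphic_map_maps homeomorphic_maps_def
  by (intro exI[of _ "sphere_translation (- t)"])
     (simp add: continuous_sphere_translation)

lemma closure_sphere_translation:
  "closure (sphere_translation t ` S) = sphere_translation t ` closure S"
  using homeomorphic_map_closure_of[OF homeomorphic_map_sphere_translation, of S t] by simp

lemma interior_sphere_translation:
  "interior (sphere_translation t ` S) = sphere_translation t ` interior S"
  using homeomorphic_map_interior_of[OF homeomorphic_map_sphere_translation, of S t] by simp

lemma homeomorphic_sphere_translation: "sphere_translation t ` S homeomorphic S"
  unfolding homeomorphic_def homeomorphism_def
  by (intro exI[of _ "sphere_translation (- t)"] exI[of _ "sphere_translation t"])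
     (auto simp: continuous_sphere_translation)

text \<open>One inclusion for all translations suffices, as the other one is its instance for the inverse.\<close>

lemma outer_disk_translation:
  "outer_disk (sphere_translation t ` A) = sphere_translation t ` outer_disk A"
proof -
  have *: "sphere_translation t ` outer_disk A \<subseteq> outer_disk (sphere_translation t ` A)" for t A
  proof (cases "None \<in> A")
    case True
    then have "connected_component_set (- A) None = {}"
      by (simp only: connected_component_eq_empty Compl_iff not_not)
    then show ?thesis unfolding outer_disk_def by (simp only: image_empty empty_subsetI)
  next
    case False
    show ?thesis
      unfolding outer_disk_def
    proof (rule connected_component_maximal)
      have "None \<in> connected_component_set (- A) None"
        using False by (simp add: connected_component_refl_eq)
      then show "None \<in> sphere_translation t ` connected_component_set (- A) None"
        by (metis imageI sphere_translation_None)
      show "connected (sphere_translation t ` connected_component_set (- A) None)"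
        by (intro connected_continuous_image continuous_sphere_translation connected_connected_component)
      show "sphere_translation t ` connected_component_set (- A) None \<subseteq> - sphere_translation t ` A"
        using image_mono[OF connected_component_subset[of "- A" None], of "sphere_translation t"]
        by (simp add: bij_image_Compl_eq[OF bij_sphere_translation])
    qed
  qed
  have "sphere_translation t ` sphere_translation (- t) ` outer_disk (sphere_translation t ` A)
      \<subseteq> sphere_translation t ` outer_disk (sphere_translation (- t) ` sphere_translation t ` A)"
    by (intro image_mono *)
  with *[of t A] show ?thesis by simp
qed

lemma inner_disk_translation:
  "inner_disk (sphere_translation t ` A) = sphere_translation t ` inner_disk A"
  unfolding inner_disk_def outer_disk_translation
  by (simp add: image_set_diff[OF bij_is_inj[OF bij_sphere_translation]]
      bij_image_Compl_eq[OF bij_sphere_translation])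

lemma core_curve_translation:
  assumes "core_curve A \<gamma>"
  shows "core_curve (sphere_translation t ` A) (sphere_translation t ` \<gamma>)"
  unfolding core_curve_def
proof (intro conjI)
  let ?h = "sphere_translation t" and ?h' = "sphere_translation (- t)"
  have gA: "\<gamma> \<subseteq> interior A" and inj: "pi1_injective \<gamma> A" and jc: "jordan_curve \<gamma>"
    using assms by (auto simp: core_curve_def)
  obtain g where g: "simple_path g" "pathfinish g = pathstart g" "\<gamma> = path_image g"
    using jc by (auto simp: jordan_curve_def)
  have "simple_path (?h \<circ> g)"
    unfolding simple_path_def
  proof
    show "path (?h \<circ> g)"
      using g(1) by (auto simp: simple_path_def intro!: path_continuous_image continuous_sphere_translation)
    show "loop_free (?h \<circ> g)"
      using g(1) by (simp add: simple_path_def loop_free_def inj_eq[OF bij_is_inj[OF bij_sphere_translation]])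
  qed
  then show "jordan_curve (?h ` \<gamma>)"
    unfolding jordan_curve_def
    by (intro exI[of _ "?h \<circ> g"]) (simp add: g pathfinish_compose pathstart_compose path_image_compose)
  show "?h ` \<gamma> \<subseteq> interior (?h ` A)"
    using gA by (auto simp: interior_sphere_translation)
  show "pi1_injective (?h ` \<gamma>) (?h ` A)"
    unfolding pi1_injective_def
  proof (intro conjI allI impI)
    show "?h ` \<gamma> \<subseteq> ?h ` A"
      using inj by (auto simp: pi1_injective_def)
  next
    fix p q
    assume "path p \<and> path_image p \<subseteq> ?h ` \<gamma> \<and> pathfinish p = pathstart p \<and>
      path q \<and> path_image q \<subseteq> ?h ` \<gamma> \<and> pathfinish q = pathstart q \<and>
      pathstart p = pathstart q \<and> homotopic_paths (?h ` A) p q"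
    then have p: "path p" "path_image p \<subseteq> ?h ` \<gamma>" "pathfinish p = pathstart p"
      and q: "path q" "path_image q \<subseteq> ?h ` \<gamma>" "pathfinish q = pathstart q"
      and pq: "pathstart p = pathstart q" "homotopic_paths (?h ` A) p q"
      by blast+
    have "homotopic_paths A (?h' \<circ> p) (?h' \<circ> q)"
      by (rule homotopic_paths_continuous_image[OF pq(2) continuous_sphere_translation]) auto
    moreover have "path (?h' \<circ> p)" "path (?h' \<circ> q)"
      using p q by (auto intro!: path_continuous_image continuous_sphere_translation)
    moreover have "path_image (?h' \<circ> p) \<subseteq> \<gamma>" "path_image (?h' \<circ> q) \<subseteq> \<gamma>"
      using p(2) q(2) by (auto simp: path_image_compose)
    ultimately have "homotopic_paths \<gamma> (?h' \<circ> p) (?h' \<circ> q)"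
      using inj p(3) q(3) pq(1) unfolding pi1_injective_def
      by (simp add: pathfinish_compose pathstart_compose)
    then have "homotopic_paths (?h ` \<gamma>) (?h \<circ> (?h' \<circ> p)) (?h \<circ> (?h' \<circ> q))"
      by (rule homotopic_paths_continuous_image[OF _ continuous_sphere_translation]) auto
    then show "homotopic_paths (?h ` \<gamma>) p q"
      by (simp add: comp_assoc[symmetric])
  qed
qed

lemma closed_annuli_translation:
  assumes A: "A \<in> closed_annuli" shows "sphere_translation t ` A \<in> closed_annuli"
proof -
  let ?h = "sphere_translation t"
  obtain U R \<gamma> where U: "open U" "U homeomorphic {z::complex. 1 < norm z \<and> norm z < 2}"
      "U \<inter> sphere_exterior R = {}" "A = closure U"
    and \<gamma>: "core_curve A \<gamma>"
    and disks: "outer_disk A homeomorphic ball (0::complex) 1" "inner_disk A homeomorphic ball (0::complex) 1"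
    using A by (auto simp: closed_annuli_def)
  have "open (?h ` U)"
    using interior_sphere_translation[of t U] U(1) by (metis interior_open open_interior)
  moreover have "?h ` U homeomorphic {z::complex. 1 < norm z \<and> norm z < 2}"
    using homeomorphic_sphere_translation U(2) by (rule homeomorphic_trans)
  moreover have "?h ` U \<inter> sphere_exterior (R + norm t) = {}"
  proof -
    have "Some z \<notin> U" if "R + norm t < norm (z - t)" for z
      using that U(3) norm_triangle_ineq4[of z t] by (auto simp: sphere_exterior_def)
    moreover have "None \<notin> U" using U(3) by (auto simp: sphere_exterior_def)
    ultimately show ?thesis
      by (auto simp: sphere_exterior_def sphere_translation_def split: option.splits)
  qed
  moreover have "?h ` A = closure (?h ` U)"
    by (simp add: U(4) closure_sphere_translation)
  moreover have "outer_disk (?h ` A) homeomorphic ball (0::complex) 1"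
    unfolding outer_disk_translation using homeomorphic_sphere_translation disks(1) by (rule homeomorphic_trans)
  moreover have "inner_disk (?h ` A) homeomorphic ball (0::complex) 1"
    unfolding inner_disk_translation using homeomorphic_sphere_translation disks(2) by (rule homeomorphic_trans)
  ultimately show ?thesis
    using core_curve_translation[OF \<gamma>, of t] unfolding closed_annuli_def by blast
qed

lemma basin_infinity_conjugate:
  "basin_infinity (inv (sphere_translation t) \<circ> F \<circ> sphere_translation t)
    = sphere_translation (- t) ` basin_infinity F"
proof -
  let ?h = "sphere_translation t" and ?h' = "sphere_translation (- t)"
  have iter: "((?h' \<circ> F \<circ> ?h) ^^ k) p = ?h' ((F ^^ k) (?h p))" for k p
    by (induction k) simp_all
  have lim: "(\<lambda>k. sphere_translation u (x k)) \<longlonglongrightarrow> None" if "x \<longlonglongrightarrow> None" for x u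
    using continuous_on_tendsto_compose[OF continuous_sphere_translation[of UNIV u] that] by simp
  have "(\<lambda>k. ?h' (x k)) \<longlonglongrightarrow> None \<longleftrightarrow> x \<longlonglongrightarrow> None" for x
    using lim[of x "- t"] lim[of "\<lambda>k. ?h' (x k)" t] by auto
  then have "p \<in> basin_infinity (?h' \<circ> F \<circ> ?h) \<longleftrightarrow> ?h p \<in> basin_infinity F" for p
    by (simp add: basin_infinity_def iter)
  moreover have "?h p \<in> S \<longleftrightarrow> p \<in> ?h' ` S" for p S
    by (metis image_iff sphere_translation_inverse)
  ultimately show ?thesis
    unfolding inv_sphere_translation by blast
qed

text \<open>The Julia set is the common frontier of the filled Julia set and of the basin. It avoids the
interiors of both, hence both disks; and a path from one disk's frontier to the other's leads from
the basin to the filled Julia set, so it must cross.\<close>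

lemma julia_in_annulus:
  assumes inner: "closure (inner_disk A) \<subseteq> interior (filled_julia F)"
    and outer: "closure (outer_disk A) \<subseteq> interior (basin_infinity F)"
  shows "julia F \<subseteq> A"
    and "path g \<Longrightarrow> pathstart g \<in> frontier (outer_disk A) \<Longrightarrow> pathfinish g \<in> frontier (inner_disk A)
      \<Longrightarrow> path_image g \<inter> julia F \<noteq> {}"
proof -
  have "julia F \<inter> interior (filled_julia F) = {}" "julia F \<inter> interior (basin_infinity F) = {}"
    by (auto simp: julia_def frontier_def filled_julia_def closure_interior)
  then have "julia F \<inter> (inner_disk A \<union> outer_disk A) = {}"
    using inner outer closure_subset by blast
  then show "julia F \<subseteq> A" by (auto simp: inner_disk_def)
  assume g: "path g" "pathstart g \<in> frontier (outer_disk A)" "pathfinish g \<in> frontier (inner_disk A)"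
  have "pathstart g \<notin> filled_julia F"
    using g(2) outer interior_subset by (force simp: frontier_def filled_julia_def)
  moreover have "pathfinish g \<in> filled_julia F"
    using g(3) inner interior_subset by (force simp: frontier_def)
  ultimately show "path_image g \<inter> julia F \<noteq> {}"
    unfolding julia_def using pathstart_in_path_image[of g] pathfinish_in_path_image[of g]
    by (intro connected_Int_frontier connected_path_image g(1)) blast+
qed

theorem theorem1p6:
  fixes \<gamma> :: "riemann_sphere set \<Rightarrow> riemann_sphere set"
    and f :: "riemann_sphere set \<Rightarrow> riemann_sphere \<Rightarrow> riemann_sphere"
    and \<epsilon> :: "riemann_sphere set \<Rightarrow> real"
    and A :: "riemann_sphere set"
    and t :: complex
  assumes choices: "\<And>B. B \<in> closed_annuli \<Longrightarrow> admissible_choice B (\<gamma> B) (f B) (\<epsilon> B)"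
    and A: "A \<in> closed_annuli"
    and t: "Some t \<in> inner_disk A"
  shows "\<exists>N::nat. \<forall>n\<ge>N.
    (let \<tau> = sphere_translation t;
         P = sphere_poly (annulus_poly (rescaled_map (f (\<tau> ` A)) (\<epsilon> (\<tau> ` A))) n);
         F = inv \<tau> \<circ> P \<circ> \<tau>
     in inner_disk A \<subseteq> filled_julia F \<and>
        outer_disk A \<subseteq> basin_infinity F \<and>
        julia F \<subseteq> A \<and>
        (\<forall>g. path g \<and> pathstart g \<in> frontier (outer_disk A) \<and>
             pathfinish g \<in> frontier (inner_disk A)
             \<longrightarrow> path_image g \<inter> julia F \<noteq> {}))"
proof -
  define \<tau> where "\<tau> = sphere_translation t"
  define \<tau>' where "\<tau>' = sphere_translation (- t)"
  define B where "B = \<tau> ` A"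
  define P where "P n = sphere_poly (annulus_poly (rescaled_map (f B) (\<epsilon> B)) n)" for n
  define F where "F n = inv \<tau> \<circ> P n \<circ> \<tau>" for n
  have B: "B \<in> closed_annuli"
    unfolding B_def \<tau>_def by (rule closed_annuli_translation[OF A])
  have "\<tau> (Some t) \<in> inner_disk B"
    unfolding B_def \<tau>_def inner_disk_translation using t by (rule imageI)
  then have "Some 0 \<in> inner_disk B"
    by (simp add: \<tau>_def sphere_translation_def)
  from annulus_poly_separates_disks[OF B choices[OF B] this]
  obtain N where N: "\<And>n. n \<ge> N \<Longrightarrow> closure (inner_disk B) \<subseteq> interior (filled_julia (P n))"
    "\<And>n. n \<ge> N \<Longrightarrow> closure (outer_disk B) \<subseteq> interior (basin_infinity (P n))"
    by (auto simp: P_def Let_def)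
  have basin: "basin_infinity (F n) = \<tau>' ` basin_infinity (P n)" for n
    unfolding F_def \<tau>_def \<tau>'_def by (rule basin_infinity_conjugate)
  then have filled: "filled_julia (F n) = \<tau>' ` filled_julia (P n)" for n
    by (simp add: filled_julia_def \<tau>'_def bij_image_Compl_eq[OF bij_sphere_translation])
  have pull: "closure (inner_disk A) = \<tau>' ` closure (inner_disk B)"
    "closure (outer_disk A) = \<tau>' ` closure (outer_disk B)"
    by (simp_all add: B_def \<tau>_def \<tau>'_def inner_disk_translation outer_disk_translation closure_sphere_translation)
  show ?thesis
  proof (intro exI[of _ N] allI impI)
    fix n assume n: "N \<le> n"
    have inner: "closure (inner_disk A) \<subseteq> interior (filled_julia (F n))"
      unfolding pull filled \<tau>'_def interior_sphere_translation by (intro image_mono N n)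
    have outer: "closure (outer_disk A) \<subseteq> interior (basin_infinity (F n))"
      unfolding pull basin \<tau>'_def interior_sphere_translation by (intro image_mono N n)
    have "inner_disk A \<subseteq> filled_julia (F n)" "outer_disk A \<subseteq> basin_infinity (F n)"
      using inner outer closure_subset interior_subset by blast+
    with julia_in_annulus[OF inner outer]
    show "let \<tau> = sphere_translation t;
         P = sphere_poly (annulus_poly (rescaled_map (f (\<tau> ` A)) (\<epsilon> (\<tau> ` A))) n);
         F = inv \<tau> \<circ> P \<circ> \<tau>
     in inner_disk A \<subseteq> filled_julia F \<and>
        outer_disk A \<subseteq> basin_infinity F \<and>
        julia F \<subseteq> A \<and>
        (\<forall>g. path g \<and> pathstart g \<in> frontier (outer_disk A) \<and>
             pathfinish g \<in> frontier (inner_disk A)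
             \<longrightarrow> path_image g \<inter> julia F \<noteq> {})"
      unfolding Let_def F_def P_def B_def \<tau>_def by blast
  qed
qed

end
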